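(* If $G$ is any topological group, then for every $f\in\mathcal{E}(G)$ and every $u\in\mathcal{E}'(G)$ we have $f*u\in\mathcal{E}(G)$.
   Context: All topological groups are Hausdorff. For a topological group $G$, $\mathfrak{L}(G)$ is the set of all continuous group homomorphisms $\gamma\colon(\mathbb{R},+)\to G$, with the topology of uniform convergence on compact subsets of $\mathbb{R}$ (a neighborhood basis at $\gamma_1$ is given by the sets $\{\gamma_2\mid \gamma_2(t)\gamma_1(t)^{-1}\in U\ \forall t\in[-n,n]\}$, $n\in\mathbb{N}$, $U$ a neighborhood of $\mathbf{1}\in G$). Put $\mathfrak{L}^k(G)=\mathfrak{L}(G)\times\cdots\times\mathfrak{L}(G)$ ($k$ times). For $\varphi\colon G\to\mathbb{C}$, $\gamma\in\mathfrak{L}(G)$, $g\in G$, put $(D^\lambda_\gamma\varphi)(g)=\lim_{t\to0}\frac{\varphi(g\gamma(t))-\varphi(g)}{t}$ if the limit exists. $\mathcal{C}^1(G)$ is the set of continuous $\varphi\colon G\to\mathbb{C}$ for which $(g;\gamma)\mapsto(D^\lambda_\gamma\varphi)(g)$ is well defined and continuous on $G\times\mathfrak{L}(G)$. For $n\ge2$, $\mathcal{C}^n(G)$ is the set of $\varphi\in\mathcal{C}^{n-1}(G)$ for which $(g;\gamma_1,\dots,\gamma_n)\mapsto(D^\lambda_{\gamma_n}(\cdots(D^\lambda_{\gamma_1}\varphi)\cdots))(g)$ is well defined and continuous on $G\times\mathfrak{L}^n(G)$. $\mathcal{C}^\infty(G)=\bigcap_{n\ge1}\mathcal{C}^n(G)$.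 For $\gamma=(\gamma_1,\dots,\gamma_n)\in\mathfrak{L}^n(G)$ write $D^\lambda_\gamma\varphi=D^\lambda_{\gamma_n}(\cdots(D^\lambda_{\gamma_1}\varphi)\cdots)$. $\mathcal{E}(G)$ is the space $\mathcal{C}^\infty(G)$ with the locally convex topology defined by the seminorms $f\mapsto\sup\{|(D^\lambda_\gamma f)(x)|\mid\gamma\in K_1,\ x\in K_2\}$, for all $k\ge1$, compact $K_1\subseteq\mathfrak{L}^k(G)$ and compact $K_2\subseteq G$, together with the order-zero seminorms $f\mapsto\sup_{x\in K_2}|f(x)|$. $\mathcal{E}'(G)$ is the space of continuous linear functionals $u\colon\mathcal{E}(G)\to\mathbb{C}$. For $\varphi\in\mathcal{E}(G)$ put $\check\varphi(x)=\varphi(x^{-1})$ (one has $\check\varphi\in\mathcal{E}(G)$), and for $u\in\mathcal{E}'(G)$ put $\check u(\varphi)=u(\check\varphi)$ (one has $\check u\in\mathcal{E}'(G)$). With $L_x(y)=xy$ (one has $\varphi\circ L_x\in\mathcal{E}(G)$), the convolution is the function $\varphi*u\colon G\to\mathbb{C}$, $(\varphi*u)(x)=\check u(\varphi\circ L_x)$. *)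

theory Defs
  imports "HOL-Analysis.Analysis"
begin

text \<open>
  A Hausdorff topological group is a type of class
  \<open>{topological_group_add, t2_space}\<close>. The class \<^class>\<open>group_add\<close> does not assume
  commutativity, so this is an arbitrary group written additively: \<open>g h\<close> is \<open>g + h\<close>,
  \<open>g h\<^sup>-\<^sup>1\<close> is \<open>g - h\<close>, and the neutral element is \<open>0\<close>.
\<close>

definition one_param :: "(real \<Rightarrow> 'a::{topological_group_add,t2_space}) set" where
  "one_param = {\<gamma>. continuous_on UNIV \<gamma> \<and> (\<forall>s t. \<gamma> (s + t) = \<gamma> s + \<gamma> t)}"

definition one_param_nbhd ::
  "(real \<Rightarrow> 'a::{topological_group_add,t2_space}) \<Rightarrow> nat \<Rightarrow> 'a set \<Rightarrow> (real \<Rightarrow> 'a) set" where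
  "one_param_nbhd \<gamma>\<^sub>1 n U =
     {\<gamma>\<^sub>2 \<in> one_param. \<forall>t\<in>{- real n..real n}. \<gamma>\<^sub>2 t - \<gamma>\<^sub>1 t \<in> U}"

definition one_param_top :: "(real \<Rightarrow> 'a::{topological_group_add,t2_space}) topology" where
  "one_param_top = topology (\<lambda>W. W \<subseteq> one_param \<and>
     (\<forall>\<gamma>\<in>W. \<exists>n U. open U \<and> 0 \<in> U \<and> one_param_nbhd \<gamma> n U \<subseteq> W))"

lemma openin_one_param_top:
  "openin one_param_top W \<longleftrightarrow> W \<subseteq> one_param \<and>
     (\<forall>\<gamma>\<in>W. \<exists>n U. open U \<and> 0 \<in> U \<and> one_param_nbhd \<gamma> n U \<subseteq> W)"
proof -
  let ?P = "\<lambda>W. W \<subseteq> one_param \<and>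
     (\<forall>\<gamma>\<in>W. \<exists>n U. open U \<and> (0::'a) \<in> U \<and> one_param_nbhd \<gamma> n U \<subseteq> W)"
  have "istopology ?P"
    unfolding istopology_def
  proof (intro conjI allI impI)
    fix S T assume S: "?P S" and T: "?P T"
    then show "S \<inter> T \<subseteq> one_param" by blast
    show "\<forall>\<gamma>\<in>S \<inter> T. \<exists>n U. open U \<and> 0 \<in> U \<and> one_param_nbhd \<gamma> n U \<subseteq> S \<inter> T"
    proof
      fix \<gamma> assume "\<gamma> \<in> S \<inter> T"
      with S T obtain m U n V where
        *: "open U" "0 \<in> U" "one_param_nbhd \<gamma> m U \<subseteq> S"
           "open V" "0 \<in> V" "one_param_nbhd \<gamma> n V \<subseteq> T"
        by (meson IntD1 IntD2)
      have "one_param_nbhd \<gamma> (max m n) (U \<inter> V) \<subseteq>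
              one_param_nbhd \<gamma> m U \<inter> one_param_nbhd \<gamma> n V"
        unfolding one_param_nbhd_def by (force simp: max_def split: if_splits)
      with * show "\<exists>n U. open U \<and> 0 \<in> U \<and> one_param_nbhd \<gamma> n U \<subseteq> S \<inter> T"
        by (intro exI[of _ "max m n"] exI[of _ "U \<inter> V"]) auto
    qed
  next
    fix \<K> assume K: "\<forall>W\<in>\<K>. ?P W"
    then show "\<Union>\<K> \<subseteq> one_param" by blast
    show "\<forall>\<gamma>\<in>\<Union>\<K>. \<exists>n U. open U \<and> 0 \<in> U \<and> one_param_nbhd \<gamma> n U \<subseteq> \<Union>\<K>"
      using K by (meson UnionE Union_upper subset_trans)
  qed
  then show ?thesis
    unfolding one_param_top_def by (simp add: topology_inverse')
qed

lemma topspace_one_param_top: "topspace one_param_top = one_param"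
proof (rule subset_antisym)
  show "topspace one_param_top \<subseteq> one_param"
    using openin_one_param_top openin_topspace by blast
  have "openin one_param_top one_param"
    unfolding openin_one_param_top one_param_nbhd_def by blast
  then show "one_param \<subseteq> topspace one_param_top"
    by (rule openin_subset)
qed

text \<open>
  The \<open>k\<close>-fold power of the space of one-parameter subgroups; a tuple
  \<open>(\<gamma>\<^sub>1, \<dots>, \<gamma>\<^sub>k)\<close> is a function on \<open>{..<k}\<close>, with \<open>\<gamma>\<^sub>i\<close> at index \<open>i - 1\<close>.
\<close>

definition one_param_pow ::
  "nat \<Rightarrow> (nat \<Rightarrow> real \<Rightarrow> 'a::{topological_group_add,t2_space}) topology" where
  "one_param_pow k = product_topology (\<lambda>_. one_param_top) {..<k}"

definition diff_quot ::
  "(real \<Rightarrow> 'a::{topological_group_add,t2_space}) \<Rightarrow> ('a \<Rightarrow> complex) \<Rightarrow> 'a \<Rightarrow> real \<Rightarrow> complex" where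
  "diff_quot \<gamma> \<phi> g t = (\<phi> (g + \<gamma> t) - \<phi> g) / of_real t"

definition has_dir_deriv ::
  "(real \<Rightarrow> 'a::{topological_group_add,t2_space}) \<Rightarrow> ('a \<Rightarrow> complex) \<Rightarrow> 'a \<Rightarrow> bool" where
  "has_dir_deriv \<gamma> \<phi> g \<longleftrightarrow> (\<exists>l. (diff_quot \<gamma> \<phi> g \<longlongrightarrow> l) (at 0))"

definition dir_deriv ::
  "(real \<Rightarrow> 'a::{topological_group_add,t2_space}) \<Rightarrow> ('a \<Rightarrow> complex) \<Rightarrow> 'a \<Rightarrow> complex" where
  "dir_deriv \<gamma> \<phi> g = Lim (at 0) (diff_quot \<gamma> \<phi> g)"

primrec iter_deriv ::
  "nat \<Rightarrow> (nat \<Rightarrow> real \<Rightarrow> 'a::{topological_group_add,t2_space}) \<Rightarrow> ('a \<Rightarrow> complex) \<Rightarrow> 'a \<Rightarrow> complex"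
where
  "iter_deriv 0 \<gamma> \<phi> = \<phi>"
| "iter_deriv (Suc k) \<gamma> \<phi> = dir_deriv (\<gamma> k) (iter_deriv k \<gamma> \<phi>)"

text \<open>
  \<open>C_fun 0\<close> consists of the continuous functions, so that \<open>C_fun 1\<close> and the
  recursion from \<open>C_fun n\<close> to \<open>C_fun (n + 1)\<close>, \<open>n \<ge> 1\<close>, have the same form. For
  \<open>\<phi> \<in> C_fun n\<close> the derivatives of order at most \<open>n\<close> exist everywhere, hence only the
  existence of the last limit has to be demanded.
\<close>

primrec C_fun :: "nat \<Rightarrow> ('a::{topological_group_add,t2_space} \<Rightarrow> complex) set" where
  "C_fun 0 = {\<phi>. continuous_on UNIV \<phi>}"
| "C_fun (Suc n) = {\<phi> \<in> C_fun n.
     (\<forall>\<gamma>\<in>topspace (one_param_pow (Suc n)). \<forall>g. has_dir_deriv (\<gamma> n) (iter_deriv n \<gamma> \<phi>) g) \<and>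
     continuous_map (prod_topology euclidean (one_param_pow (Suc n))) euclidean
       (\<lambda>(g, \<gamma>). iter_deriv (Suc n) \<gamma> \<phi> g)}"

definition C_infty :: "('a::{topological_group_add,t2_space} \<Rightarrow> complex) set" where
  "C_infty = (\<Inter>n\<in>{1..}. C_fun n)"

text \<open>
  Suprema of nonnegative quantities are taken in \<open>[0, \<infinity>)\<close>: inserting \<open>0\<close> matters only
  for empty index sets, where \<open>Sup {}\<close> is unspecified for reals. On \<^const>\<open>C_infty\<close> the
  sets below are bounded, by continuity and compactness.
\<close>

definition seminorm0 ::
  "'a::{topological_group_add,t2_space} set \<Rightarrow> ('a \<Rightarrow> complex) \<Rightarrow> real" where
  "seminorm0 K\<^sub>2 f = Sup (insert 0 {cmod (f x) | x. x \<in> K\<^sub>2})"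

definition seminorm ::
  "nat \<Rightarrow> (nat \<Rightarrow> real \<Rightarrow> 'a::{topological_group_add,t2_space}) set \<Rightarrow> 'a set
     \<Rightarrow> ('a \<Rightarrow> complex) \<Rightarrow> real" where
  "seminorm k K\<^sub>1 K\<^sub>2 f =
     Sup (insert 0 {cmod (iter_deriv k \<gamma> f x) | \<gamma> x. \<gamma> \<in> K\<^sub>1 \<and> x \<in> K\<^sub>2})"

definition E_seminorms :: "(('a::{topological_group_add,t2_space} \<Rightarrow> complex) \<Rightarrow> real) set" where
  "E_seminorms =
     {seminorm0 K\<^sub>2 | K\<^sub>2. compact K\<^sub>2} \<union>
     {seminorm k K\<^sub>1 K\<^sub>2 | k K\<^sub>1 K\<^sub>2. 1 \<le> k \<and> compactin (one_param_pow k) K\<^sub>1 \<and> compact K\<^sub>2}"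

definition E_space :: "('a::{topological_group_add,t2_space} \<Rightarrow> complex) topology" where
  "E_space = topology_generated_by
     {{h \<in> C_infty. p (\<lambda>x. h x - f x) < \<epsilon>} | p f \<epsilon>. p \<in> E_seminorms \<and> f \<in> C_infty \<and> 0 < \<epsilon>}"

lemma topspace_E_space: "topspace E_space = C_infty"
proof -
  let ?B = "\<lambda>p f \<epsilon>. {h \<in> C_infty. p (\<lambda>x. h x - f x) < \<epsilon>} :: ('a \<Rightarrow> complex) set"
  have "seminorm0 {} \<in> (E_seminorms :: (('a \<Rightarrow> complex) \<Rightarrow> real) set)"
    unfolding E_seminorms_def using compact_empty by blast
  then have "?B (seminorm0 {}) f 1 \<in> {?B p f \<epsilon> | p f \<epsilon>. p \<in> E_seminorms \<and> f \<in> C_infty \<and> 0 < \<epsilon>}"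
    if "f \<in> C_infty" for f
    using that zero_less_one by blast
  moreover have "f \<in> ?B (seminorm0 {}) f 1" if "f \<in> C_infty" for f
    using that by (simp add: seminorm0_def)
  ultimately have "C_infty \<subseteq> \<Union>{?B p f \<epsilon> | p f \<epsilon>. p \<in> E_seminorms \<and> f \<in> C_infty \<and> 0 < \<epsilon>}"
    by (meson UnionI subsetI)
  then show ?thesis
    unfolding E_space_def topology_generated_by_topspace by blast
qed

text \<open>
  Functionals are total functions on \<open>'a \<Rightarrow> complex\<close>; only their values on
  \<^const>\<open>C_infty\<close> are relevant.
\<close>

definition E_dual :: "(('a::{topological_group_add,t2_space} \<Rightarrow> complex) \<Rightarrow> complex) set" where
  "E_dual = {u. continuous_map E_space euclidean u \<and>
     (\<forall>f\<in>C_infty. \<forall>g\<in>C_infty. u (\<lambda>x. f x + g x) = u f + u g) \<and>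
     (\<forall>c. \<forall>f\<in>C_infty. u (\<lambda>x. c * f x) = c * u f)}"

definition check_fun ::
  "('a::{topological_group_add,t2_space} \<Rightarrow> complex) \<Rightarrow> 'a \<Rightarrow> complex" where
  "check_fun \<phi> x = \<phi> (- x)"

definition check_dual ::
  "(('a::{topological_group_add,t2_space} \<Rightarrow> complex) \<Rightarrow> complex) \<Rightarrow> ('a \<Rightarrow> complex) \<Rightarrow> complex"
where
  "check_dual u \<phi> = u (check_fun \<phi>)"

definition conv ::
  "('a::{topological_group_add,t2_space} \<Rightarrow> complex) \<Rightarrow> (('a \<Rightarrow> complex) \<Rightarrow> complex)
     \<Rightarrow> 'a \<Rightarrow> complex" where
  "conv \<phi> u x = check_dual u (\<phi> \<circ> (\<lambda>y. x + y))"

end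

theory Submission
  imports Defs
begin

text \<open>
  Write \<open>R\<^sub>z h (y) = h (y z)\<close>. Everything reduces to one claim: for \<open>h \<in> \<E>(G)\<close> and
  \<open>u \<in> \<E>'(G)\<close> the function \<open>Q (x) = u (R\<^sub>z h)\<close> with \<open>z = x\<^sup>-\<^sup>1\<close> is smooth. For \<open>u\<close> the
  evaluation at the neutral element, \<open>Q\<close> is \<open>h\<close> composed with inversion, so \<open>\<E>(G)\<close> is closed
  under inversion; and \<open>f * u\<close> is \<open>Q\<close> for \<open>h (x) = f (x\<^sup>-\<^sup>1)\<close>.

  The claim follows from
  \<open>D\<^bsub>\<gamma>n\<^esub> \<dots> D\<^bsub>\<gamma>1\<^esub> Q (x) = u (D\<^bsub>\<delta>1\<^esub> \<dots> D\<^bsub>\<delta>n\<^esub> R\<^sub>z h)\<close> with \<open>\<delta>i = \<gamma>i\<^sup>-\<^sup>1\<close> (the order of the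
  derivatives is reversed), whose right-hand side is jointly continuous. Differentiating under \<open>u\<close>
  requires \<open>(R\<^bsub>\<beta>(t)\<^esub> h - h) / t \<rightarrow> D\<^sub>\<beta> h\<close> in \<open>\<E>(G)\<close>. This rests on the identity
  \<open>d/dt D\<^sub>\<alpha> R\<^bsub>\<beta>(t)\<^esub> h = D\<^sub>\<alpha> R\<^bsub>\<beta>(t)\<^esub> D\<^sub>\<beta> h\<close>, an interchange of mixed partial derivatives along
  \<open>(s, t) \<mapsto> y \<alpha>(s) \<beta>(t)\<close>, and on the mean value inequality; uniformity on compact sets comes from the
  tube lemma.
\<close>

subsection \<open>One-parameter subgroups\<close>

lemma continuous_map_group_add:
  fixes f g :: "'b \<Rightarrow> 'a::topological_group_add"
  assumes "continuous_map X euclidean f" "continuous_map X euclidean g"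
  shows "continuous_map X euclidean (\<lambda>x. f x + g x)"
  using assms by (simp add: continuous_map_atin tendsto_add)

lemma continuous_map_group_minus:
  fixes f :: "'b \<Rightarrow> 'a::topological_group_add"
  assumes "continuous_map X euclidean f"
  shows "continuous_map X euclidean (\<lambda>x. - f x)"
  using assms by (simp add: continuous_map_atin tendsto_minus)

lemma continuous_map_group_diff:
  fixes f g :: "'b \<Rightarrow> 'a::topological_group_add"
  assumes "continuous_map X euclidean f" "continuous_map X euclidean g"
  shows "continuous_map X euclidean (\<lambda>x. f x - g x)"
  using assms by (simp add: continuous_map_atin tendsto_diff)

text \<open>The preimage of \<open>U\<close> is an open set containing
  \<open>{x} \<times> K\<close>, so by compactness of \<open>K\<close> it contains a whole tube.
  Every passage from pointwise to uniform estimates on compact sets goes through this lemma.\<close>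

lemma tube_preimage:
  assumes F: "continuous_map (prod_topology X Y) Z F" and K: "compactin Y K"
    and x: "x \<in> topspace X" and U: "openin Z U" and sub: "\<And>k. k \<in> K \<Longrightarrow> F (x, k) \<in> U"
  obtains S where "openin X S" "x \<in> S" "\<And>y k. y \<in> S \<Longrightarrow> k \<in> K \<Longrightarrow> F (y, k) \<in> U"
proof -
  let ?W = "{p \<in> topspace (prod_topology X Y). F p \<in> U}"
  have "openin (prod_topology X Y) ?W"
    by (rule openin_continuous_map_preimage[OF F U])
  moreover have "{x} \<times> K \<subseteq> ?W"
    using x sub compactin_subset_topspace[OF K] by auto
  ultimately obtain S J where "openin X S" "x \<in> S" "K \<subseteq> J" "S \<times> J \<subseteq> ?W"
    using tube_lemma_right[OF _ K x, of ?W] by blast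
  then show thesis by (intro that[of S]) auto
qed

text \<open>The topology only asks open sets to contain a basic neighborhood of each of their
  points, so openness of the basic sets themselves needs the group structure. With \<open>\<epsilon>
  - \<gamma> = (\<epsilon> - \<delta>) + (\<delta> - \<gamma>)\<close>, the tube lemma on the
  compact interval yields one \<open>V\<close> such that adding an element of \<open>V\<close> on
  the left of any \<open>\<delta> t - \<gamma> t\<close> stays in \<open>U\<close>.\<close>

lemma openin_one_param_nbhd:
  assumes \<gamma>: "\<gamma> \<in> one_param" and U: "open U"
  shows "openin one_param_top (one_param_nbhd \<gamma> n U)"
  unfolding openin_one_param_top
proof (intro conjI ballI)
  show "one_param_nbhd \<gamma> n U \<subseteq> one_param"
    by (auto simp: one_param_nbhd_def)
  fix \<delta> assume \<delta>: "\<delta> \<in> one_param_nbhd \<gamma> n U"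
  let ?I = "{- real n..real n}" and ?R = "euclidean :: real topology"
  let ?h = "\<lambda>p::'a \<times> real. fst p + (\<delta> (snd p) - \<gamma> (snd p))"
  have cont: "continuous_map ?R euclidean \<gamma>" "continuous_map ?R euclidean \<delta>"
    using \<gamma> \<delta> by (auto simp: one_param_nbhd_def one_param_def)
  have "continuous_map (prod_topology euclidean ?R) euclidean ?h"
    by (intro continuous_map_group_add continuous_map_group_diff continuous_map_fst
        continuous_map_compose[OF continuous_map_snd cont(1), unfolded comp_def]
        continuous_map_compose[OF continuous_map_snd cont(2), unfolded comp_def])
  then obtain V where V: "open V" "0 \<in> V" "\<And>v t. v \<in> V \<Longrightarrow> t \<in> ?I \<Longrightarrow> ?h (v, t) \<in> U"
    by (rule tube_preimage[where K = ?I and x = 0 and U = U])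
      (use U \<delta> in \<open>auto simp: one_param_nbhd_def\<close>)
  have "one_param_nbhd \<delta> n V \<subseteq> one_param_nbhd \<gamma> n U"
  proof
    fix \<epsilon> assume \<epsilon>: "\<epsilon> \<in> one_param_nbhd \<delta> n V"
    have "\<epsilon> t - \<gamma> t \<in> U" if "t \<in> ?I" for t
    proof -
      have "\<epsilon> t - \<delta> t \<in> V" using \<epsilon> that by (auto simp: one_param_nbhd_def)
      then have "\<epsilon> t - \<delta> t + (\<delta> t - \<gamma> t) \<in> U" using V(3)[OF _ that] by simp
      then show ?thesis by (simp add: add_diff_eq)
    qed
    then show "\<epsilon> \<in> one_param_nbhd \<gamma> n U" using \<epsilon> by (auto simp: one_param_nbhd_def)
  qed
  with V show "\<exists>m V. open V \<and> 0 \<in> V \<and> one_param_nbhd \<delta> m V \<subseteq> one_param_nbhd \<gamma> n U"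
    by blast
qed

text \<open>
  The next two lemmas are currying for the compact-open topology: since \<open>\<real>\<close> is locally compact,
  a map into \<^const>\<open>one_param_top\<close> is continuous iff it is jointly continuous in the parameter and
  the time.
\<close>

lemma continuous_map_one_param_eval:
  assumes c: "continuous_map X one_param_top c" and \<tau>: "continuous_map X euclideanreal \<tau>"
  shows "continuous_map X euclidean (\<lambda>x. c x (\<tau> x))"
  unfolding continuous_map_atin limitin_canonical_iff
proof (intro ballI topological_tendstoI)
  fix x O' assume x: "x \<in> topspace X" and O': "open O'" "c x (\<tau> x) \<in> O'"
  have cx: "c x \<in> one_param"
    using continuous_map_image_subset_topspace[OF c] x by (auto simp: topspace_one_param_top)
  have "((\<lambda>p. fst p + snd p) \<longlongrightarrow> 0 + c x (\<tau> x)) (nhds 0 \<times>\<^sub>F nhds (c x (\<tau> x)))"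
    by (intro tendsto_intros filterlim_fst filterlim_snd)
  then have "eventually (\<lambda>p. fst p + snd p \<in> O') (nhds 0 \<times>\<^sub>F nhds (c x (\<tau> x)))"
    by (rule topological_tendstoD) (use O' in auto)
  then obtain V W where V: "open V" "0 \<in> V" and W: "open W" "c x (\<tau> x) \<in> W"
      and VW: "\<And>v w. v \<in> V \<Longrightarrow> w \<in> W \<Longrightarrow> v + w \<in> O'"
    unfolding eventually_prod_filter eventually_nhds by force
  \<comment> \<open>\<open>one_param_nbhd\<close> controls paths only on \<open>[-n, n]\<close>;
    this \<open>n\<close> keeps \<open>\<tau> y\<close> in that window for \<open>y\<close> near
    \<open>x\<close>. There \<open>c y (\<tau> y)\<close> is a sum of
    \<open>c y (\<tau> y) - c x (\<tau> y)\<close>, lying in \<open>V\<close>, and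
    \<open>c x (\<tau> y)\<close>, lying in \<open>W\<close>.\<close>
  obtain n where n: "\<bar>\<tau> x\<bar> < real n" using reals_Archimedean2 by blast
  have "continuous_map X euclidean (\<lambda>y. c x (\<tau> y))"
    using continuous_map_compose[OF \<tau>, of euclidean "c x"] cx by (auto simp: one_param_def comp_def)
  then have "((\<lambda>y. c x (\<tau> y)) \<longlongrightarrow> c x (\<tau> x)) (atin X x)"
    using x by (auto simp: continuous_map_atin)
  then have 1: "\<forall>\<^sub>F y in atin X x. c x (\<tau> y) \<in> W" by (rule topological_tendstoD[OF _ W])
  have "(\<tau> \<longlongrightarrow> \<tau> x) (atin X x)"
    using x \<tau> by (auto simp: continuous_map_atin)
  then have 2: "\<forall>\<^sub>F y in atin X x. \<tau> y \<in> {- real n <..< real n}"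
    by (rule topological_tendstoD) (use n in auto)
  have "limitin one_param_top c (c x) (atin X x)"
    using x c by (auto simp: continuous_map_atin)
  then have 3: "\<forall>\<^sub>F y in atin X x. c y \<in> one_param_nbhd (c x) n V"
    by (rule limitinD[OF _ openin_one_param_nbhd[OF cx V(1)]]) (use V cx in \<open>auto simp: one_param_nbhd_def\<close>)
  show "\<forall>\<^sub>F y in atin X x. c y (\<tau> y) \<in> O'"
    using 1 2 3
  proof eventually_elim
    case (elim y)
    then have "c y (\<tau> y) - c x (\<tau> y) + c x (\<tau> y) \<in> O'"
      by (intro VW) (auto simp: one_param_nbhd_def)
    then show ?case by simp
  qed
qed

lemma continuous_map_one_paramI:
  assumes op: "\<And>x. x \<in> topspace X \<Longrightarrow> c x \<in> one_param"
    and cont: "continuous_map (prod_topology X euclideanreal) euclidean (\<lambda>p. c (fst p) (snd p))"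
  shows "continuous_map X one_param_top c"
  unfolding continuous_map_def
proof (intro conjI allI impI)
  show "c \<in> topspace X \<rightarrow> topspace one_param_top"
    using op by (auto simp: topspace_one_param_top)
  fix W :: "(real \<Rightarrow> 'b) set" assume W: "openin one_param_top W"
  show "openin X {x \<in> topspace X. c x \<in> W}"
  proof (subst openin_subopen, safe)
    fix x assume x: "x \<in> topspace X" "c x \<in> W"
    then obtain n U where U: "open U" "0 \<in> U" "one_param_nbhd (c x) n U \<subseteq> W"
      using W by (auto simp: openin_one_param_top)
    let ?P = "prod_topology X euclideanreal" and ?I = "{- real n..real n}"
    \<comment> \<open>This difference vanishes on \<open>{x} \<times> ?I\<close>, so near
      \<open>x\<close> it stays in \<open>U\<close> for all times in the compact interval at
      once.\<close>
    let ?h = "\<lambda>p. c (fst p) (snd p) - c x (snd p)"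
    have cx: "continuous_map euclideanreal euclidean (c x)"
      using op[OF x(1)] by (auto simp: one_param_def)
    have "continuous_map ?P euclidean ?h"
      by (intro continuous_map_group_diff cont continuous_map_compose[OF continuous_map_snd cx, unfolded comp_def])
    then obtain S where S: "openin X S" "x \<in> S" "\<And>y t. y \<in> S \<Longrightarrow> t \<in> ?I \<Longrightarrow> ?h (y, t) \<in> U"
      by (rule tube_preimage[where K = ?I and x = x and U = U]) (use U x in auto)
    have "c y \<in> W" if "y \<in> S" for y
    proof -
      have "y \<in> topspace X" using that S(1) openin_subset by blast
      moreover have "c y t - c x t \<in> U" if "t \<in> ?I" for t
        using S(3)[OF \<open>y \<in> S\<close> that] by simp
      ultimately show ?thesis using op U(3) by (auto simp: one_param_nbhd_def)
    qed
    then show "\<exists>S. openin X S \<and> x \<in> S \<and> S \<subseteq> {x \<in> topspace X. c x \<in> W}"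
      using S(1,2) openin_subset[OF S(1)] by (intro exI[of _ S]) blast
  qed
qed

section \<open>Conjugates and inverses of one-parameter subgroups\<close>

definition conj_path :: "'a \<Rightarrow> (real \<Rightarrow> 'a::group_add) \<Rightarrow> real \<Rightarrow> 'a" where
  "conj_path z \<gamma> t = z + \<gamma> t - z"

definition neg_path :: "(real \<Rightarrow> 'a::group_add) \<Rightarrow> real \<Rightarrow> 'a" where
  "neg_path \<gamma> t = - \<gamma> t"

lemma one_param_add: "\<gamma> \<in> one_param \<Longrightarrow> \<gamma> (s + t) = \<gamma> s + \<gamma> t"
  by (simp add: one_param_def)

lemma one_param_zero:
  assumes "\<gamma> \<in> one_param" shows "\<gamma> 0 = 0"
proof -
  have "\<gamma> 0 + \<gamma> 0 = \<gamma> 0 + 0" using one_param_add[OF assms, of 0 0] by simp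
  then show ?thesis by (simp only: add_left_cancel)
qed

lemma conj_path_one_param:
  assumes "\<gamma> \<in> one_param" shows "conj_path z \<gamma> \<in> one_param"
proof -
  have "conj_path z \<gamma> (s + t) = conj_path z \<gamma> s + conj_path z \<gamma> t" for s t
    by (simp add: conj_path_def one_param_add[OF assms] diff_conv_add_uminus add.assoc
        del: add_uminus_conv_diff)
  moreover have "continuous_on UNIV (conj_path z \<gamma>)"
    using assms by (auto simp: one_param_def conj_path_def[abs_def] intro!: continuous_intros)
  ultimately show ?thesis by (simp add: one_param_def)
qed

text \<open>Inversion reverses products, but the values of a single one-parameter subgroup commute
  because \<open>s + t = t + s\<close>.\<close>

lemma neg_path_one_param:
  assumes "\<gamma> \<in> one_param" shows "neg_path \<gamma> \<in> one_param"
proof -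
  have "neg_path \<gamma> (s + t) = neg_path \<gamma> s + neg_path \<gamma> t" for s t
    using one_param_add[OF assms, of t s] by (simp add: neg_path_def add.commute[of s t] minus_add)
  moreover have "continuous_on UNIV (neg_path \<gamma>)"
    using assms by (auto simp: one_param_def neg_path_def[abs_def] intro!: continuous_intros)
  ultimately show ?thesis by (simp add: one_param_def)
qed

lemma continuous_map_one_param_const:
  "\<gamma> \<in> one_param \<Longrightarrow> continuous_map X one_param_top (\<lambda>_. \<gamma>)"
  by (simp add: topspace_one_param_top)

lemma continuous_map_one_paramD:
  "continuous_map X one_param_top c \<Longrightarrow> x \<in> topspace X \<Longrightarrow> c x \<in> one_param"
  using continuous_map_image_subset_topspace topspace_one_param_top by blast

lemma continuous_map_one_param_pair:
  assumes "continuous_map X one_param_top c"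
  shows "continuous_map (prod_topology X euclideanreal) euclidean (\<lambda>p. c (fst p) (snd p))"
  by (rule continuous_map_one_param_eval[OF _ continuous_map_snd])
    (rule continuous_map_compose[OF continuous_map_fst assms, unfolded comp_def])

text \<open>By currying, only joint continuity in parameter and time has to be checked. The
  conjugating element must be allowed to vary, since the translations considered later depend on the
  base point.\<close>

lemma continuous_map_conj_path:
  assumes a: "continuous_map X euclidean a" and c: "continuous_map X one_param_top c"
  shows "continuous_map X one_param_top (\<lambda>x. conj_path (a x) (c x))"
proof (rule continuous_map_one_paramI)
  show "continuous_map (prod_topology X euclideanreal) euclidean (\<lambda>p. conj_path (a (fst p)) (c (fst p)) (snd p))"
    unfolding conj_path_def
    by (intro continuous_map_group_add continuous_map_group_diff continuous_map_one_param_pair c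
      continuous_map_compose[OF continuous_map_fst a, unfolded comp_def])
qed (rule conj_path_one_param[OF continuous_map_one_paramD[OF c]])

lemma continuous_map_neg_path:
  assumes c: "continuous_map X one_param_top c"
  shows "continuous_map X one_param_top (\<lambda>x. neg_path (c x))"
proof (rule continuous_map_one_paramI)
  show "continuous_map (prod_topology X euclideanreal) euclidean (\<lambda>p. neg_path (c (fst p)) (snd p))"
    unfolding neg_path_def
    by (intro continuous_map_group_minus continuous_map_one_param_pair c)
qed (rule neg_path_one_param[OF continuous_map_one_paramD[OF c]])

subsection \<open>Iterated derivatives\<close>

text \<open>Points of \<open>one_param_pow k\<close> are \<open>undefined\<close> outside
  \<open>{..<k}\<close>; this lemma passes between them and arbitrary sequences of
  directions.\<close>

lemma iter_deriv_cong: "(\<And>i. i < k \<Longrightarrow> \<gamma> i = \<delta> i) \<Longrightarrow> iter_deriv k \<gamma> \<phi> = iter_deriv k \<delta> \<phi>"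
  by (induction k) simp_all

lemma topspace_one_param_pow: "topspace (one_param_pow n) = (\<Pi>\<^sub>E i\<in>{..<n}. one_param)"
  by (simp add: one_param_pow_def topspace_one_param_top)

lemma continuous_map_one_param_pow_component:
  "i < n \<Longrightarrow> continuous_map (one_param_pow n) one_param_top (\<lambda>\<gamma>. \<gamma> i)"
  unfolding one_param_pow_def by (rule continuous_map_product_projection) simp

lemma continuous_map_one_param_pow:
  assumes "\<And>i. i < n \<Longrightarrow> continuous_map X one_param_top (c i)"
  shows "continuous_map X (one_param_pow n) (\<lambda>x. \<lambda>i\<in>{..<n}. c i x)"
  unfolding one_param_pow_def continuous_map_componentwise using assms by auto

text \<open>Unrolling the recursion makes the condition at each single order directly
  accessible.\<close>

lemma C_fun_iff:
  "\<phi> \<in> C_fun n \<longleftrightarrow> continuous_on UNIV \<phi> \<and> (\<forall>m<n.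
     (\<forall>\<gamma>\<in>topspace (one_param_pow (Suc m)). \<forall>g. has_dir_deriv (\<gamma> m) (iter_deriv m \<gamma> \<phi>) g) \<and>
     continuous_map (prod_topology euclidean (one_param_pow (Suc m))) euclidean
       (\<lambda>(g, \<gamma>). iter_deriv (Suc m) \<gamma> \<phi> g))"
  by (induction n) (auto simp: less_Suc_eq simp del: iter_deriv.simps)

lemma C_infty_iff_C_fun: "\<phi> \<in> C_infty \<longleftrightarrow> (\<forall>n. \<phi> \<in> C_fun n)"
proof
  assume *: "\<phi> \<in> C_infty"
  show "\<forall>n. \<phi> \<in> C_fun n"
  proof
    fix n
    \<comment> \<open>The intersection defining \<open>C_infty\<close> starts at order 1, so order
      \<open>n\<close>, including \<open>n = 0\<close>, is read off from the next one.\<close>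
    have "\<phi> \<in> C_fun (Suc n)" using * by (simp add: C_infty_def del: C_fun.simps)
    then show "\<phi> \<in> C_fun n" by simp
  qed
qed (simp add: C_infty_def)

lemma C_infty_has_dir_deriv:
  assumes h: "h \<in> C_infty" and \<alpha>: "\<And>i. i < n \<Longrightarrow> \<alpha> i \<in> one_param" and \<beta>: "\<beta> \<in> one_param"
  shows "has_dir_deriv \<beta> (iter_deriv n \<alpha> h) g"
proof -
  \<comment> \<open>The new direction is put in the last slot, and the restriction makes the tuple a
    point of the product space.\<close>
  let ?\<gamma> = "\<lambda>i\<in>{..<Suc n}. if i = n then \<beta> else \<alpha> i"
  have "?\<gamma> \<in> topspace (one_param_pow (Suc n))"
    using \<alpha> \<beta> by (auto simp: topspace_one_param_pow)
  moreover have "h \<in> C_fun (Suc n)" using h C_infty_iff_C_fun by blast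
  ultimately have "has_dir_deriv (?\<gamma> n) (iter_deriv n ?\<gamma> h) g"
    unfolding C_fun_iff[of _ "Suc n"] by blast
  moreover have "iter_deriv n ?\<gamma> h = iter_deriv n \<alpha> h"
    by (rule iter_deriv_cong) auto
  ultimately show ?thesis by simp
qed

lemma C_infty_continuous_pow:
  assumes h: "h \<in> C_infty"
  shows "continuous_map (prod_topology euclidean (one_param_pow n)) euclidean (\<lambda>(g, \<gamma>). iter_deriv n \<gamma> h g)"
proof (cases n)
  case 0
  have "continuous_map euclidean euclidean h"
    using h by (auto simp: C_infty_iff_C_fun dest: spec[of _ 0])
  then have "continuous_map (prod_topology euclidean (one_param_pow 0)) euclidean (h \<circ> fst)"
    by (rule continuous_map_compose[OF continuous_map_fst])
  then show ?thesis using 0 by (simp add: comp_def case_prod_unfold)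
next
  case (Suc m)
  then have "h \<in> C_fun (Suc m)" using h C_infty_iff_C_fun by blast
  then show ?thesis unfolding C_fun_iff[of _ "Suc m"] Suc by blast
qed

text \<open>The working form of joint continuity: compose it with the continuous map sending a
  parameter to its base point and tuple of directions.\<close>

lemma continuous_map_iter_deriv:
  assumes h: "h \<in> C_infty" and a: "continuous_map X euclidean a"
    and c: "\<And>i. i < n \<Longrightarrow> continuous_map X one_param_top (c i)"
  shows "continuous_map X euclidean (\<lambda>x. iter_deriv n (\<lambda>i. c i x) h (a x))"
proof -
  have "continuous_map X (prod_topology euclidean (one_param_pow n)) (\<lambda>x. (a x, \<lambda>i\<in>{..<n}. c i x))"
    by (intro continuous_map_pairedI a continuous_map_one_param_pow c)
  from continuous_map_compose[OF this C_infty_continuous_pow[OF h]]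
  have "continuous_map X euclidean (\<lambda>x. iter_deriv n (\<lambda>i\<in>{..<n}. c i x) h (a x))"
    by (simp add: comp_def)
  moreover have "iter_deriv n (\<lambda>i\<in>{..<n}. c i x) h = iter_deriv n (\<lambda>i. c i x) h" for x
    by (rule iter_deriv_cong) simp
  ultimately show ?thesis by simp
qed

lemma C_inftyI:
  assumes D: "\<And>n \<alpha> \<beta> g. (\<And>i. i < n \<Longrightarrow> \<alpha> i \<in> one_param) \<Longrightarrow> \<beta> \<in> one_param \<Longrightarrow>
      has_dir_deriv \<beta> (iter_deriv n \<alpha> h) g"
    and C: "\<And>n. continuous_map (prod_topology euclidean (one_param_pow n)) euclidean
      (\<lambda>p. iter_deriv n (snd p) h (fst p))"
  shows "h \<in> C_infty"
  unfolding C_infty_iff_C_fun C_fun_iff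
proof (intro allI conjI impI ballI)
  \<comment> \<open>\<open>one_param_pow 0\<close> has the single point
    \<open>\<lambda>_. undefined\<close>, so \<open>C\<close> at order 0 is continuity of
    \<open>h\<close>.\<close>
  have "continuous_map euclidean (prod_topology euclidean (one_param_pow 0)) (\<lambda>x. (x, \<lambda>_. undefined))"
    by (intro continuous_map_pairedI) (auto simp: topspace_one_param_pow)
  from continuous_map_compose[OF this C[of 0]] show "continuous_on UNIV h"
    by (simp add: comp_def)
next
  fix m \<gamma> g assume "\<gamma> \<in> topspace (one_param_pow (Suc m) :: (nat \<Rightarrow> real \<Rightarrow> 'a) topology)"
  then show "has_dir_deriv (\<gamma> m) (iter_deriv m \<gamma> h) g"
    unfolding topspace_one_param_pow by (intro D) (simp_all add: PiE_iff)
next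
  fix m
  show "continuous_map (prod_topology euclidean (one_param_pow (Suc m))) euclidean
       (\<lambda>(g, \<gamma>). iter_deriv (Suc m) \<gamma> h g)"
    using C[of "Suc m"] by (simp only: case_prod_unfold)
qed

lemma has_dir_deriv_tendsto:
  "has_dir_deriv \<beta> \<phi> g \<Longrightarrow> (diff_quot \<beta> \<phi> g \<longlongrightarrow> dir_deriv \<beta> \<phi> g) (at 0)"
  unfolding has_dir_deriv_def dir_deriv_def by (metis tendsto_Lim trivial_limit_at)

lemma dir_deriv_eqI:
  assumes "(diff_quot \<beta> \<phi> g \<longlongrightarrow> l) (at 0)"
  shows "has_dir_deriv \<beta> \<phi> g" "dir_deriv \<beta> \<phi> g = l"
  using assms unfolding has_dir_deriv_def dir_deriv_def by (auto intro: tendsto_Lim)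

text \<open>Since \<open>g + \<beta> t + \<beta> s = g + \<beta> (t + s)\<close>, the directional
  derivative at a point of the curve is an ordinary derivative along it. This gives access to
  one-variable calculus.\<close>

lemma diff_quot_tendsto_iff:
  assumes \<beta>: "\<beta> \<in> one_param"
  shows "(diff_quot \<beta> \<phi> (g + \<beta> t) \<longlongrightarrow> l) (at 0) \<longleftrightarrow>
    ((\<lambda>s. \<phi> (g + \<beta> s)) has_vector_derivative l) (at t)"
proof -
  have "((\<lambda>s. \<phi> (g + \<beta> s)) has_vector_derivative l) (at t) \<longleftrightarrow>
      ((\<lambda>s. cmod (\<phi> (g + \<beta> (t + s)) - \<phi> (g + \<beta> t) - s *\<^sub>R l) / norm s) \<longlongrightarrow> 0) (at 0)"
    unfolding has_vector_derivative_def has_derivative_at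
    by (simp add: bounded_linear_scaleR_left)
  also have "\<dots> \<longleftrightarrow> ((\<lambda>s. cmod (diff_quot \<beta> \<phi> (g + \<beta> t) s - l)) \<longlongrightarrow> 0) (at 0)"
  proof (rule tendsto_cong, rule eventually_at_filter[THEN iffD2], rule always_eventually, intro allI impI)
    fix s :: real assume s: "s \<noteq> 0"
    have "g + \<beta> t + \<beta> s = g + \<beta> (t + s)" by (simp only: one_param_add[OF \<beta>] add.assoc)
    then have "diff_quot \<beta> \<phi> (g + \<beta> t) s - l =
       (\<phi> (g + \<beta> (t + s)) - \<phi> (g + \<beta> t) - s *\<^sub>R l) / of_real s"
      using s by (simp add: diff_quot_def scaleR_conv_of_real diff_divide_distrib)
    then show "cmod (\<phi> (g + \<beta> (t + s)) - \<phi> (g + \<beta> t) - s *\<^sub>R l) / norm s = cmod (diff_quot \<beta> \<phi> (g + \<beta> t) s - l)"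
      by (simp add: norm_divide)
  qed
  also have "\<dots> \<longleftrightarrow> (diff_quot \<beta> \<phi> (g + \<beta> t) \<longlongrightarrow> l) (at 0)"
    by (simp add: tendsto_norm_zero_iff LIM_zero_iff)
  finally show ?thesis by blast
qed

lemma C_infty_vector_derivative:
  assumes h: "h \<in> C_infty" and \<alpha>: "\<And>i. i < n \<Longrightarrow> \<alpha> i \<in> one_param" and \<beta>: "\<beta> \<in> one_param"
  shows "((\<lambda>t. iter_deriv n \<alpha> h (g + \<beta> t)) has_vector_derivative
     dir_deriv \<beta> (iter_deriv n \<alpha> h) (g + \<beta> t)) (at t)"
  unfolding diff_quot_tendsto_iff[OF \<beta>, symmetric]
  by (intro has_dir_deriv_tendsto C_infty_has_dir_deriv h \<alpha> \<beta>)

section \<open>Translates, derivatives and linear combinations of smooth functions\<close>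

definition rshift :: "'a::group_add \<Rightarrow> ('a \<Rightarrow> complex) \<Rightarrow> 'a \<Rightarrow> complex" where
  "rshift z h y = h (y + z)"

text \<open>In multiplicative notation \<open>y \<gamma>(t) z = (y z) (z^-1 \<gamma>(t) z)\<close>:
  moving a translation past a left-invariant derivative conjugates the direction.\<close>

lemma iter_deriv_rshift:
  "iter_deriv k \<gamma> (rshift z h) = rshift z (iter_deriv k (\<lambda>i. conj_path (- z) (\<gamma> i)) h)"
proof (induction k)
  case (Suc k)
  have "diff_quot \<beta> (rshift z \<phi>) g = diff_quot (conj_path (- z) \<beta>) \<phi> (g + z)" for \<beta> :: "real \<Rightarrow> 'a" and \<phi> g
    by (simp add: fun_eq_iff diff_quot_def rshift_def conj_path_def add.assoc)
  then have "dir_deriv \<beta> (rshift z \<phi>) = rshift z (dir_deriv (conj_path (- z) \<beta>) \<phi>)" for \<beta> :: "real \<Rightarrow> 'a" and \<phi>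
    by (intro ext) (simp add: dir_deriv_def rshift_def)
  with Suc show ?case by simp
qed simp

lemma iter_deriv_iter_deriv:
  "iter_deriv n \<alpha> (iter_deriv k \<gamma> h) = iter_deriv (k + n) (\<lambda>i. if i < k then \<gamma> i else \<alpha> (i - k)) h"
proof (induction n)
  case 0
  show ?case by (auto intro: iter_deriv_cong)
qed simp

text \<open>\<open>iter_deriv\<close> appends directions at the end, whereas a derivative taken
  first is prepended at index 0. This is the source of the reversed order under
  \<open>u\<close>.\<close>

lemma iter_deriv_dir_deriv:
  "iter_deriv n \<alpha> (dir_deriv \<beta> h) = iter_deriv (Suc n) (\<lambda>i. if i = 0 then \<beta> else \<alpha> (i - 1)) h"
  using iter_deriv_iter_deriv[of n \<alpha> 1 "\<lambda>_. \<beta>" h]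
  by (simp del: iter_deriv.simps(2) add: iter_deriv.simps(2)[of 0])

text \<open>By concatenation of tuples, derivatives of a derivative of \<open>h\<close> are
  derivatives of \<open>h\<close> itself with the first \<open>k\<close> directions frozen.\<close>

lemma C_infty_iter_deriv:
  assumes h: "h \<in> C_infty" and \<gamma>: "\<And>i. i < k \<Longrightarrow> \<gamma> i \<in> one_param"
  shows "iter_deriv k \<gamma> h \<in> C_infty"
proof (rule C_inftyI)
  fix n :: nat and \<alpha> :: "nat \<Rightarrow> real \<Rightarrow> 'a" and \<beta> :: "real \<Rightarrow> 'a" and g assume \<alpha>: "\<And>i. i < n \<Longrightarrow> \<alpha> i \<in> one_param" and \<beta>: "\<beta> \<in> one_param"
  show "has_dir_deriv \<beta> (iter_deriv n \<alpha> (iter_deriv k \<gamma> h)) g"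
    unfolding iter_deriv_iter_deriv by (rule C_infty_has_dir_deriv[OF h _ \<beta>]) (use \<alpha> \<gamma> in auto)
next
  fix n
  let ?X = "prod_topology euclidean (one_param_pow n) :: ('a \<times> (nat \<Rightarrow> real \<Rightarrow> 'a)) topology"
  have "continuous_map ?X one_param_top (\<lambda>p. if i < k then \<gamma> i else snd p (i - k))" if "i < k + n" for i
  proof (cases "i < k")
    case False
    then have "i - k < n" using that by auto
    from continuous_map_compose[OF continuous_map_snd continuous_map_one_param_pow_component[OF this]] False
    show ?thesis by (simp add: comp_def)
  qed (simp add: topspace_one_param_top \<gamma>)
  from continuous_map_iter_deriv[OF h continuous_map_fst this]
  show "continuous_map ?X euclidean (\<lambda>p. iter_deriv n (snd p) (iter_deriv k \<gamma> h) (fst p))"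
    unfolding iter_deriv_iter_deriv .
qed

lemma continuous_map_iter_deriv_rshift:
  assumes h: "h \<in> C_infty" and a: "continuous_map X euclidean a" and z: "continuous_map X euclidean z"
    and c: "\<And>i. i < n \<Longrightarrow> continuous_map X one_param_top (c i)"
  shows "continuous_map X euclidean (\<lambda>x. iter_deriv n (\<lambda>i. c i x) (rshift (z x) h) (a x))"
  unfolding iter_deriv_rshift unfolding rshift_def
  by (intro continuous_map_iter_deriv h continuous_map_group_add a z continuous_map_conj_path
      continuous_map_group_minus c)

lemma C_infty_rshift:
  assumes h: "h \<in> C_infty"
  shows "rshift z h \<in> C_infty"
proof (rule C_inftyI)
  fix n :: nat and \<alpha> :: "nat \<Rightarrow> real \<Rightarrow> 'a" and \<beta> :: "real \<Rightarrow> 'a" and g assume \<alpha>: "\<And>i. i < n \<Longrightarrow> \<alpha> i \<in> one_param" and \<beta>: "\<beta> \<in> one_param"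
  have "has_dir_deriv (conj_path (- z) \<beta>) (iter_deriv n (\<lambda>i. conj_path (- z) (\<alpha> i)) h) (g + z)"
    by (rule C_infty_has_dir_deriv[OF h]) (auto intro: conj_path_one_param \<alpha> \<beta>)
  moreover have "diff_quot (conj_path (- z) \<beta>) \<phi> (g + z) = diff_quot \<beta> (rshift z \<phi>) g" for \<phi>
    by (simp add: fun_eq_iff diff_quot_def rshift_def conj_path_def add.assoc)
  ultimately show "has_dir_deriv \<beta> (iter_deriv n \<alpha> (rshift z h)) g"
    unfolding iter_deriv_rshift has_dir_deriv_def by simp
next
  fix n
  show "continuous_map (prod_topology euclidean (one_param_pow n)) euclidean
      (\<lambda>p. iter_deriv n (snd p) (rshift z h) (fst p))"
    by (rule continuous_map_iter_deriv_rshift[OF h continuous_map_fst])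
      (auto intro: continuous_map_compose[OF continuous_map_snd continuous_map_one_param_pow_component, unfolded comp_def])
qed

text \<open>Smoothness of \<open>f\<close> and \<open>g\<close> guarantees that all limits involved
  exist; \<open>Lim\<close> is additive only then.\<close>

lemma iter_deriv_linear:
  assumes f: "f \<in> C_infty" and g: "g \<in> C_infty" and \<alpha>: "\<And>i. i < k \<Longrightarrow> \<alpha> i \<in> one_param"
  shows "iter_deriv k \<alpha> (\<lambda>x. c * f x + d * g x) = (\<lambda>x. c * iter_deriv k \<alpha> f x + d * iter_deriv k \<alpha> g x)"
  using \<alpha>
proof (induction k)
  case (Suc k)
  note H = C_infty_has_dir_deriv[OF f, of k \<alpha> "\<alpha> k", THEN has_dir_deriv_tendsto]
    C_infty_has_dir_deriv[OF g, of k \<alpha> "\<alpha> k", THEN has_dir_deriv_tendsto]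
  have "dir_deriv (\<alpha> k) (\<lambda>x. c * iter_deriv k \<alpha> f x + d * iter_deriv k \<alpha> g x) x =
      c * dir_deriv (\<alpha> k) (iter_deriv k \<alpha> f) x + d * dir_deriv (\<alpha> k) (iter_deriv k \<alpha> g) x" for x
  proof (rule dir_deriv_eqI(2))
    have "diff_quot (\<alpha> k) (\<lambda>x. c * iter_deriv k \<alpha> f x + d * iter_deriv k \<alpha> g x) x =
      (\<lambda>t. c * diff_quot (\<alpha> k) (iter_deriv k \<alpha> f) x t + d * diff_quot (\<alpha> k) (iter_deriv k \<alpha> g) x t)"
      by (auto simp: fun_eq_iff diff_quot_def algebra_simps add_divide_distrib diff_divide_distrib)
    moreover have "(\<dots> \<longlongrightarrow> c * dir_deriv (\<alpha> k) (iter_deriv k \<alpha> f) x + d * dir_deriv (\<alpha> k) (iter_deriv k \<alpha> g) x) (at 0)"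
      by (intro tendsto_intros H) (use Suc.prems in auto)
    ultimately show "(diff_quot (\<alpha> k) (\<lambda>x. c * iter_deriv k \<alpha> f x + d * iter_deriv k \<alpha> g x) x \<longlongrightarrow>
      c * dir_deriv (\<alpha> k) (iter_deriv k \<alpha> f) x + d * dir_deriv (\<alpha> k) (iter_deriv k \<alpha> g) x) (at 0)" by simp
  qed
  with Suc show ?case by simp
qed simp

lemma C_infty_linear:
  assumes f: "f \<in> C_infty" and g: "g \<in> C_infty"
  shows "(\<lambda>x. c * f x + d * g x) \<in> C_infty"
proof (rule C_inftyI)
  fix n :: nat and \<alpha> :: "nat \<Rightarrow> real \<Rightarrow> 'a" and \<beta> :: "real \<Rightarrow> 'a" and x assume \<alpha>: "\<And>i. i < n \<Longrightarrow> \<alpha> i \<in> one_param" and \<beta>: "\<beta> \<in> one_param"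
  have "diff_quot \<beta> (\<lambda>x. c * iter_deriv n \<alpha> f x + d * iter_deriv n \<alpha> g x) x =
      (\<lambda>t. c * diff_quot \<beta> (iter_deriv n \<alpha> f) x t + d * diff_quot \<beta> (iter_deriv n \<alpha> g) x t)"
    by (auto simp: fun_eq_iff diff_quot_def algebra_simps add_divide_distrib diff_divide_distrib)
  moreover have "(\<dots> \<longlongrightarrow> c * dir_deriv \<beta> (iter_deriv n \<alpha> f) x + d * dir_deriv \<beta> (iter_deriv n \<alpha> g) x) (at 0)"
    by (intro tendsto_intros has_dir_deriv_tendsto C_infty_has_dir_deriv f g \<alpha> \<beta>)
  moreover have "iter_deriv n \<alpha> (\<lambda>x. c * f x + d * g x) = (\<lambda>x. c * iter_deriv n \<alpha> f x + d * iter_deriv n \<alpha> g x)"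
    by (rule iter_deriv_linear[OF f g \<alpha>])
  ultimately show "has_dir_deriv \<beta> (iter_deriv n \<alpha> (\<lambda>x. c * f x + d * g x)) x"
    unfolding has_dir_deriv_def by auto
next
  fix n
  let ?X = "prod_topology euclidean (one_param_pow n) :: ('a \<times> (nat \<Rightarrow> real \<Rightarrow> 'a)) topology"
  have "continuous_map ?X euclidean (\<lambda>p. c * iter_deriv n (snd p) f (fst p) + d * iter_deriv n (snd p) g (fst p))"
    using C_infty_continuous_pow[OF f, of n] C_infty_continuous_pow[OF g, of n]
    unfolding case_prod_unfold continuous_map_atin limitin_canonical_iff
    by (intro ballI tendsto_add tendsto_mult_left) blast+
  then show "continuous_map ?X euclidean (\<lambda>p. iter_deriv n (snd p) (\<lambda>x. c * f x + d * g x) (fst p))"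
  proof (rule continuous_map_eq)
    fix p assume "p \<in> topspace ?X"
    then have "snd p i \<in> one_param" if "i < n" for i
      using that by (cases p) (simp add: topspace_one_param_pow PiE_iff)
    then show "c * iter_deriv n (snd p) f (fst p) + d * iter_deriv n (snd p) g (fst p) =
        iter_deriv n (snd p) (\<lambda>x. c * f x + d * g x) (fst p)"
      by (simp add: iter_deriv_linear[OF f g])
  qed
qed

subsection \<open>Differentiation along right translations\<close>

text \<open>A form of Schwarz's theorem in which the existence of the second mixed partial is a
  conclusion. Write \<open>F s r - F s a\<close> as the integral of \<open>Ft s\<close> over
  \<open>[a, r]\<close>, differentiate in \<open>s\<close> under the integral, then apply the
  fundamental theorem of calculus in \<open>r\<close>.\<close>

lemma mixed_partials:
  fixes F :: "real \<Rightarrow> real \<Rightarrow> complex"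
  assumes Fs: "\<And>s t. ((\<lambda>s. F s t) has_vector_derivative Fs s t) (at s)"
    and Ft: "\<And>s t. ((\<lambda>t. F s t) has_vector_derivative Ft s t) (at t)"
    and Fts: "\<And>s t. ((\<lambda>s. Ft s t) has_vector_derivative Fts s t) (at s)"
    and cont: "continuous_on UNIV (\<lambda>(s, t). Fts s t)"
  shows "((\<lambda>t. Fs s t) has_vector_derivative Fts s t) (at t)"
proof -
  \<comment> \<open>Any base point below \<open>t\<close> would do; \<open>t\<close> becomes an
    interior point of \<open>[a, t + 1]\<close>, so one-sided derivatives do not arise.\<close>
  define a where "a = t - 1"
  have int: "(Ft s has_integral (F s r - F s a)) {a..r}" if "a \<le> r" for s r
    by (rule fundamental_theorem_of_calculus) (use that Ft in \<open>auto intro: has_vector_derivative_at_within\<close>)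
  have eq: "Fs s r = Fs s a + integral {a..r} (Fts s)" if r: "a \<le> r" for r
  proof -
    have "((\<lambda>s. integral (cbox a r) (Ft s)) has_vector_derivative integral (cbox a r) (Fts s)) (at s within UNIV)"
      by (rule leibniz_rule_vector_derivative)
        (use int[OF r] Fts in \<open>auto intro: continuous_on_subset[OF cont]\<close>)
    moreover have "integral (cbox a r) (Ft s) = F s r - F s a" for s
      using int[OF r, of s] by (simp add: integral_unique)
    ultimately have "((\<lambda>s. F s r - F s a) has_vector_derivative integral {a..r} (Fts s)) (at s)" by simp
    moreover have "((\<lambda>s. F s r - F s a) has_vector_derivative (Fs s r - Fs s a)) (at s)"
      by (intro derivative_intros Fs)
    ultimately have "integral {a..r} (Fts s) = Fs s r - Fs s a"
      by (rule vector_derivative_unique_at)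
    then show ?thesis by simp
  qed
  have "continuous_on {a..t+1} (Fts s)"
    using continuous_on_compose2[OF cont continuous_on_Pair[OF continuous_on_const continuous_on_id, of "{a..t+1}" s]] by simp
  then have "((\<lambda>r. integral {a..r} (Fts s)) has_vector_derivative Fts s t) (at t within {a..t+1})"
    by (rule integral_has_vector_derivative) (auto simp: a_def)
  then have "((\<lambda>r. integral {a..r} (Fts s)) has_vector_derivative Fts s t) (at t)"
    by (simp add: at_within_Icc_at a_def)
  from has_vector_derivative_add[OF has_vector_derivative_const[of "Fs s a"] this]
  have "((\<lambda>r. Fs s a + integral {a..r} (Fts s)) has_vector_derivative Fts s t) (at t)" by simp
  then show ?thesis
    \<comment> \<open>The identity \<open>eq\<close> holds only for \<open>a \<le> r\<close>, which
      includes the open neighborhood \<open>{a<..}\<close> of \<open>t\<close>.\<close>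
    by (rule has_vector_derivative_transform_within_open[where S = "{a<..}"])
      (simp_all add: a_def eq[symmetric, unfolded a_def])
qed

lemma C_infty_dir_deriv: "h \<in> C_infty \<Longrightarrow> \<beta> \<in> one_param \<Longrightarrow> dir_deriv \<beta> h \<in> C_infty"
  using C_infty_iter_deriv[of h 1 "\<lambda>_. \<beta>"] by simp

text \<open>Induction on \<open>k\<close>. The function of \<open>(s, t)\<close> given by
  \<open>iter_deriv k \<alpha> (rshift (\<beta> t) h) (y + \<alpha> k s)\<close> has its
  \<open>s\<close>-derivative from smoothness and its \<open>t\<close>-derivative from the induction
  hypothesis at the moved point; interchanging the two yields the next order.\<close>

lemma rshift_vector_derivative:
  assumes h: "h \<in> C_infty" and \<beta>: "\<beta> \<in> one_param" and \<alpha>: "\<And>i. i < k \<Longrightarrow> \<alpha> i \<in> one_param"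
  shows "((\<lambda>t. iter_deriv k \<alpha> (rshift (\<beta> t) h) y) has_vector_derivative
    iter_deriv k \<alpha> (rshift (\<beta> t) (dir_deriv \<beta> h)) y) (at t)"
  using \<alpha>
proof (induction k arbitrary: y t)
  case 0
  show ?case
    using C_infty_vector_derivative[OF h _ \<beta>, of 0] by (simp add: rshift_def)
next
  case (Suc k)
  let ?h' = "dir_deriv \<beta> h"
  have \<alpha>k: "\<alpha> k \<in> one_param" using Suc.prems by simp
  note h' = C_infty_dir_deriv[OF h \<beta>]
  have \<beta>cont: "continuous_map euclideanreal euclidean \<beta>" and \<alpha>cont: "continuous_map euclideanreal euclidean (\<alpha> k)"
    using \<beta> \<alpha>k by (auto simp: one_param_def)
  \<comment> \<open>Writing \<open>y\<close> as \<open>y + \<alpha> k 0\<close> exhibits the goal as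
    the instance \<open>s = 0\<close> of \<open>mixed_partials\<close>.\<close>
  have "((\<lambda>t. iter_deriv (Suc k) \<alpha> (rshift (\<beta> t) h) (y + \<alpha> k 0)) has_vector_derivative
    iter_deriv (Suc k) \<alpha> (rshift (\<beta> t) ?h') (y + \<alpha> k 0)) (at t)"
  proof (rule mixed_partials)
    show "((\<lambda>s. iter_deriv k \<alpha> (rshift (\<beta> t) h) (y + \<alpha> k s)) has_vector_derivative
        iter_deriv (Suc k) \<alpha> (rshift (\<beta> t) h) (y + \<alpha> k s)) (at s)" for s t
      using C_infty_vector_derivative[OF C_infty_rshift[OF h] _ \<alpha>k, of k \<alpha>] Suc.prems by simp
    show "((\<lambda>s. iter_deriv k \<alpha> (rshift (\<beta> t) ?h') (y + \<alpha> k s)) has_vector_derivative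
        iter_deriv (Suc k) \<alpha> (rshift (\<beta> t) ?h') (y + \<alpha> k s)) (at s)" for s t
      using C_infty_vector_derivative[OF C_infty_rshift[OF h'] _ \<alpha>k, of k \<alpha>] Suc.prems by simp
    show "((\<lambda>t. iter_deriv k \<alpha> (rshift (\<beta> t) h) (y + \<alpha> k s)) has_vector_derivative
        iter_deriv k \<alpha> (rshift (\<beta> t) ?h') (y + \<alpha> k s)) (at t)" for s t
      using Suc by simp
    have st: "continuous_map (euclidean :: (real \<times> real) topology) euclideanreal fst"
      "continuous_map (euclidean :: (real \<times> real) topology) euclideanreal snd"
      by (auto intro: continuous_intros)
    have "continuous_map (euclidean :: (real \<times> real) topology) euclidean
        (\<lambda>p. iter_deriv (Suc k) (\<lambda>i. \<alpha> i) (rshift (\<beta> (snd p)) ?h') (y + \<alpha> k (fst p)))"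
    proof (rule continuous_map_iter_deriv_rshift[OF h'])
      show "continuous_map (euclidean :: (real \<times> real) topology) euclidean (\<lambda>p. y + \<alpha> k (fst p))"
        using continuous_map_compose[OF st(1) \<alpha>cont]
        by (intro continuous_map_group_add) (simp_all add: comp_def)
      show "continuous_map (euclidean :: (real \<times> real) topology) euclidean (\<lambda>p. \<beta> (snd p))"
        using continuous_map_compose[OF st(2) \<beta>cont] by (simp add: comp_def)
      show "continuous_map (euclidean :: (real \<times> real) topology) one_param_top (\<lambda>_. \<alpha> i)" if "i < Suc k" for i
        using Suc.prems[OF that] by (rule continuous_map_one_param_const)
    qed
    then show "continuous_on UNIV (\<lambda>(s, t). iter_deriv (Suc k) \<alpha> (rshift (\<beta> t) ?h') (y + \<alpha> k s))"
      by (simp only: continuous_map_iff_continuous2 case_prod_unfold)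
  qed
  then show ?case by (simp only: one_param_zero[OF \<alpha>k] add_0_right)
qed

subsection \<open>Convergence in the space of smooth functions\<close>

text \<open>The order-zero seminorms are the case \<open>k = 0\<close> with the one-point compact
  set \<open>{\<lambda>_. undefined}\<close>, so all seminorms can be handled uniformly.\<close>

lemma E_seminorms_cases:
  assumes "p \<in> (E_seminorms :: (('a::{topological_group_add,t2_space} \<Rightarrow> complex) \<Rightarrow> real) set)"
  obtains k K\<^sub>1 K\<^sub>2 where "p = seminorm k K\<^sub>1 K\<^sub>2" "compactin (one_param_pow k) K\<^sub>1" "compact K\<^sub>2"
proof -
  have "seminorm0 K = seminorm 0 {\<lambda>_. undefined} K" for K :: "'a set"
    by (intro ext) (simp add: seminorm0_def seminorm_def)
  moreover have "compactin (one_param_pow 0) {\<lambda>_. undefined :: real \<Rightarrow> 'a}"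
    by (simp add: topspace_one_param_pow)
  ultimately show thesis
    using assms that unfolding E_seminorms_def by blast
qed

text \<open>A real \<open>Sup\<close> is meaningful only for bounded sets. Here the values form the
  image of the compact set \<open>K2 \<times> K1\<close> under a jointly continuous map.\<close>

lemma bdd_above_iter_deriv:
  assumes f: "f \<in> C_infty" and K1: "compactin (one_param_pow k) K1" and K2: "compact K2"
  shows "bdd_above (insert 0 {cmod (iter_deriv k \<gamma> f x) | \<gamma> x. \<gamma> \<in> K1 \<and> x \<in> K2})"
proof -
  have "compactin (prod_topology euclidean (one_param_pow k)) (K2 \<times> K1)"
    using K1 K2 by (simp add: compactin_Times)
  from image_compactin[OF this C_infty_continuous_pow[OF f]]
  have "compact ((\<lambda>(g, \<gamma>). iter_deriv k \<gamma> f g) ` (K2 \<times> K1))" by simp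
  from compact_imp_bounded[OF this] obtain B
    where "\<And>g \<gamma>. g \<in> K2 \<Longrightarrow> \<gamma> \<in> K1 \<Longrightarrow> cmod (iter_deriv k \<gamma> f g) \<le> B"
    unfolding bounded_iff by auto
  then have "bdd_above {cmod (iter_deriv k \<gamma> f x) | \<gamma> x. \<gamma> \<in> K1 \<and> x \<in> K2}"
    by (intro bdd_aboveI[where M = B]) auto
  then show ?thesis by simp
qed

lemma iter_deriv_diff:
  assumes f: "f \<in> C_infty" and g: "g \<in> C_infty" and \<alpha>: "\<And>i. i < k \<Longrightarrow> \<alpha> i \<in> one_param"
  shows "iter_deriv k \<alpha> (\<lambda>x. f x - g x) = (\<lambda>x. iter_deriv k \<alpha> f x - iter_deriv k \<alpha> g x)"
  using iter_deriv_linear[OF f g \<alpha>, where c = 1 and d = "- 1"] by simp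

lemma C_infty_diff: "f \<in> C_infty \<Longrightarrow> g \<in> C_infty \<Longrightarrow> (\<lambda>x. f x - g x) \<in> C_infty"
  using C_infty_linear[of f g 1 "- 1"] by simp

text \<open>The generating sets are seminorm balls around arbitrary centers \<open>f\<close>, not
  around the limit \<open>g\<close>. The triangle inequality transfers uniform closeness to
  \<open>g\<close> to membership in such a ball.\<close>

lemma limitin_E_spaceI:
  assumes g: "g \<in> C_infty" and E: "\<forall>\<^sub>F t in F. E t \<in> C_infty"
    and lim: "\<And>k K\<^sub>1 K\<^sub>2 \<epsilon>. compactin (one_param_pow k) K\<^sub>1 \<Longrightarrow> compact K\<^sub>2 \<Longrightarrow> 0 < \<epsilon> \<Longrightarrow>
      \<forall>\<^sub>F t in F. \<forall>\<gamma>\<in>K\<^sub>1. \<forall>x\<in>K\<^sub>2. cmod (iter_deriv k \<gamma> (E t) x - iter_deriv k \<gamma> g x) < \<epsilon>"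
  shows "limitin E_space E g F"
  unfolding limitin_def topspace_E_space
proof (intro conjI allI impI g)
  fix U assume "openin E_space U \<and> g \<in> U"
  then have "generate_topology_on
     {{h \<in> C_infty. p (\<lambda>x. h x - f x) < \<epsilon>} | p f \<epsilon>. p \<in> E_seminorms \<and> f \<in> C_infty \<and> 0 < \<epsilon>} U" "g \<in> U"
    unfolding E_space_def openin_topology_generated_by_iff by auto
  then show "\<forall>\<^sub>F t in F. E t \<in> U"
  proof (induction rule: generate_topology_on.induct)
    case (Int a b)
    then show ?case by (auto intro: eventually_conj)
  next
    case (UN K)
    then obtain k where "k \<in> K" "\<forall>\<^sub>F t in F. E t \<in> k" by auto
    then show ?case by (auto elim: eventually_mono)
  next
    case (Basis s)
    then obtain p f \<epsilon> where s: "s = {h \<in> C_infty. p (\<lambda>x. h x - f x) < \<epsilon>}" "p \<in> E_seminorms"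
      and f: "f \<in> C_infty" by blast
    from s(2) obtain k K\<^sub>1 K\<^sub>2 where p: "p = seminorm k K\<^sub>1 K\<^sub>2" "compactin (one_param_pow k) K\<^sub>1" "compact K\<^sub>2"
      by (rule E_seminorms_cases)
    let ?S = "\<lambda>f. insert 0 {cmod (iter_deriv k \<gamma> f x) | \<gamma> x. \<gamma> \<in> K\<^sub>1 \<and> x \<in> K\<^sub>2}"
    let ?r = "p (\<lambda>x. g x - f x)"
    have le: "c \<le> ?r" if "c \<in> ?S (\<lambda>x. g x - f x)" for c
      unfolding p(1) seminorm_def
      by (rule cSup_upper[OF that bdd_above_iter_deriv[OF C_infty_diff[OF g f] p(2,3)]])
    have K1: "\<gamma> i \<in> one_param" if "\<gamma> \<in> K\<^sub>1" "i < k" for \<gamma> i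
      using compactin_subset_topspace[OF p(2)] that unfolding topspace_one_param_pow by fastforce
    \<comment> \<open>Half of the room between \<open>g\<close> and the boundary of the ball: the
      supremum estimate below gives only a non-strict bound, and the other half restores
      strictness.\<close>
    define \<delta> where "\<delta> = (\<epsilon> - ?r) / 2"
    have \<delta>: "0 < \<delta>" "?r + \<delta> < \<epsilon>" using Basis(2) unfolding s(1) \<delta>_def by (auto simp: field_simps)
    show ?case using E lim[OF p(2,3) \<delta>(1)]
    proof eventually_elim
      case (elim t)
      have "seminorm k K\<^sub>1 K\<^sub>2 (\<lambda>x. E t x - f x) \<le> ?r + \<delta>"
        unfolding seminorm_def
      proof (rule cSup_least)
        fix c assume "c \<in> ?S (\<lambda>x. E t x - f x)"
        then consider "c = 0" | \<gamma> x where "\<gamma> \<in> K\<^sub>1" "x \<in> K\<^sub>2" "c = cmod (iter_deriv k \<gamma> (\<lambda>x. E t x - f x) x)"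
          by blast
        then show "c \<le> ?r + \<delta>"
        proof cases
          case 1
          \<comment> \<open>The element \<open>0\<close> inserted into the supremum shows that
            \<open>?r\<close> is nonnegative.\<close>
          then show ?thesis using le[of 0] \<delta>(1) by simp
        next
          case 2
          have "cmod (iter_deriv k \<gamma> g x - iter_deriv k \<gamma> f x) \<in> ?S (\<lambda>x. g x - f x)"
            using 2(1,2) iter_deriv_diff[OF g f K1[OF 2(1)]] by force
          note le[OF this]
          moreover have "cmod (iter_deriv k \<gamma> (E t) x - iter_deriv k \<gamma> g x) < \<delta>"
            using elim(2) 2(1,2) by blast
          moreover have "c = cmod ((iter_deriv k \<gamma> (E t) x - iter_deriv k \<gamma> g x) +
              (iter_deriv k \<gamma> g x - iter_deriv k \<gamma> f x))"
            by (simp add: 2(3) iter_deriv_diff[OF elim(1) f K1[OF 2(1)]])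
          ultimately show ?thesis
            using norm_triangle_ineq[of "iter_deriv k \<gamma> (E t) x - iter_deriv k \<gamma> g x"
              "iter_deriv k \<gamma> g x - iter_deriv k \<gamma> f x"] by linarith
        qed
      qed simp
      then show ?case using elim(1) \<delta>(2) unfolding s(1) p(1) by simp
    qed
  qed simp
qed

text \<open>The currying principle for smooth functions: the seminorms are suprema over compact
  sets, so joint continuity of each derivative suffices, by the tube lemma.\<close>

lemma continuous_map_E_space:
  assumes \<Phi>: "\<And>x. x \<in> topspace X \<Longrightarrow> \<Phi> x \<in> C_infty"
    and cont: "\<And>k. continuous_map (prod_topology X (prod_topology euclidean (one_param_pow k))) euclidean
      (\<lambda>p. iter_deriv k (snd (snd p)) (\<Phi> (fst p)) (fst (snd p)))"
  shows "continuous_map X E_space \<Phi>"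
  unfolding continuous_map_atin
proof
  fix x assume x: "x \<in> topspace X"
  show "limitin E_space \<Phi> (\<Phi> x) (atin X x)"
  proof (rule limitin_E_spaceI[OF \<Phi>[OF x]])
    show "\<forall>\<^sub>F t in atin X x. \<Phi> t \<in> C_infty"
      unfolding eventually_atin using \<Phi> x by auto
    fix k and K\<^sub>1 :: "(nat \<Rightarrow> real \<Rightarrow> 'b) set" and K\<^sub>2 :: "'b set" and \<epsilon> :: real
    assume K: "compactin (one_param_pow k) K\<^sub>1" "compact K\<^sub>2" and "0 < \<epsilon>"
    let ?D = "\<lambda>p. iter_deriv k (snd (snd p)) (\<Phi> (fst p)) (fst (snd p)) -
        iter_deriv k (snd (snd p)) (\<Phi> x) (fst (snd p))"
    have "continuous_map (prod_topology X (prod_topology euclidean (one_param_pow k))) euclidean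
        ((\<lambda>(g, \<gamma>). iter_deriv k \<gamma> (\<Phi> x) g) \<circ> snd)"
      by (rule continuous_map_compose[OF continuous_map_snd C_infty_continuous_pow[OF \<Phi>[OF x]]])
    then have "continuous_map (prod_topology X (prod_topology euclidean (one_param_pow k))) euclidean ?D"
      using cont[of k] by (intro continuous_map_group_diff) (simp_all add: comp_def case_prod_unfold)
    then obtain S where "openin X S" "x \<in> S" "\<And>y q. y \<in> S \<Longrightarrow> q \<in> K\<^sub>2 \<times> K\<^sub>1 \<Longrightarrow> ?D (y, q) \<in> ball 0 \<epsilon>"
      by (rule tube_preimage[where K = "K\<^sub>2 \<times> K\<^sub>1" and x = x and U = "ball 0 \<epsilon>"])
        (use K x \<open>0 < \<epsilon>\<close> in \<open>auto simp: compactin_Times\<close>)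
    then show "\<forall>\<^sub>F t in atin X x. \<forall>\<gamma>\<in>K\<^sub>1. \<forall>y\<in>K\<^sub>2. cmod (iter_deriv k \<gamma> (\<Phi> t) y - iter_deriv k \<gamma> (\<Phi> x) y) < \<epsilon>"
      unfolding eventually_atin by (intro disjI2 exI[of _ S]) auto
  qed
qed

subsection \<open>Functionals applied to right translations\<close>

text \<open>Differentiability of translation in \<E>(G), after applying fixed derivatives
  \<open>\<gamma>\<close>. The difference quotient is spelled as a linear combination to fit the
  linearity lemmas for derivatives and for functionals.\<close>

lemma limitin_iter_deriv_rshift:
  assumes h: "h \<in> C_infty" and \<beta>: "\<beta> \<in> one_param" and \<gamma>: "\<And>i. i < m \<Longrightarrow> \<gamma> i \<in> one_param"
  shows "limitin E_space
    (\<lambda>t y. 1 / of_real t * iter_deriv m \<gamma> (rshift (\<beta> t) h) y + (- 1 / of_real t) * iter_deriv m \<gamma> h y)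
    (iter_deriv m \<gamma> (dir_deriv \<beta> h)) (at 0)"
proof (rule limitin_E_spaceI)
  let ?h' = "dir_deriv \<beta> h"
  note h' = C_infty_dir_deriv[OF h \<beta>]
  note rh = C_infty_rshift[OF h]
  show "iter_deriv m \<gamma> ?h' \<in> C_infty"
    by (rule C_infty_iter_deriv[OF h' \<gamma>])
  show "\<forall>\<^sub>F t in at 0. (\<lambda>y. 1 / of_real t * iter_deriv m \<gamma> (rshift (\<beta> t) h) y +
      (- 1 / of_real t) * iter_deriv m \<gamma> h y) \<in> C_infty"
    by (intro always_eventually allI C_infty_linear C_infty_iter_deriv rh h \<gamma>)
  fix k and K\<^sub>1 :: "(nat \<Rightarrow> real \<Rightarrow> 'a) set" and K\<^sub>2 :: "'a set" and \<epsilon> :: real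
  assume K: "compactin (one_param_pow k) K\<^sub>1" "compact K\<^sub>2" and \<epsilon>: "0 < \<epsilon>"
  \<comment> \<open>The fixed directions \<open>\<gamma>\<close> come first, then the directions
    \<open>\<alpha>\<close> of the seminorm, giving a single derivative of order
    \<open>m + k\<close>.\<close>
  define \<eta> where "\<eta> = (\<lambda>(\<alpha>::nat \<Rightarrow> real \<Rightarrow> 'a) i. if i < m then \<gamma> i else \<alpha> (i - m))"
  define D where "D = (\<lambda>p. iter_deriv (m + k) (\<eta> (snd (snd p))) (rshift (\<beta> (fst p)) ?h') (fst (snd p)))"
  let ?Y = "prod_topology (euclidean :: 'a topology) (one_param_pow k)"
  let ?X = "prod_topology euclideanreal ?Y"
  have K1: "\<alpha> i \<in> one_param" if "\<alpha> \<in> K\<^sub>1" "i < k" for \<alpha> i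
    using compactin_subset_topspace[OF K(1)] that unfolding topspace_one_param_pow by fastforce
  have \<beta>cont: "continuous_map euclideanreal euclidean \<beta>"
    using \<beta> by (auto simp: one_param_def)
  have fst1: "continuous_map ?X euclideanreal fst" and snd2: "continuous_map ?X ?Y snd"
    by (rule continuous_map_fst continuous_map_snd)+
  have "continuous_map ?X euclidean D"
    unfolding D_def
  proof (rule continuous_map_iter_deriv_rshift[OF h'])
    show "continuous_map ?X euclidean (\<lambda>p. fst (snd p))"
      using continuous_map_compose[OF snd2 continuous_map_fst] by (simp add: comp_def)
    show "continuous_map ?X euclidean (\<lambda>p. \<beta> (fst p))"
      using continuous_map_compose[OF fst1 \<beta>cont] by (simp add: comp_def)
    show "continuous_map ?X one_param_top (\<lambda>p. \<eta> (snd (snd p)) i)" if i: "i < m + k" for i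
    proof (cases "i < m")
      case True
      then show ?thesis by (simp add: \<eta>_def continuous_map_one_param_const \<gamma> del: continuous_map_const)
    next
      case False
      then have "i - m < k" using i by simp
      from continuous_map_compose[OF continuous_map_compose[OF snd2 continuous_map_snd]
          continuous_map_one_param_pow_component[OF this]] False
      show ?thesis by (simp add: \<eta>_def comp_def)
    qed
  qed
  moreover have "continuous_map ?X euclidean (\<lambda>p. D (0, snd p))"
  proof -
    have "continuous_map ?X ?X (\<lambda>p. (0, snd p))"
      by (intro continuous_map_pairedI continuous_map_snd) simp
    from continuous_map_compose[OF this \<open>continuous_map ?X euclidean D\<close>] show ?thesis
      by (simp add: comp_def)
  qed
  \<comment> \<open>This difference vanishes at time 0, so the tube lemma bounds it by
    \<open>\<epsilon> / 2\<close> on \<open>K\<^sub>2 \<times> K\<^sub>1\<close> for all small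
    times.\<close>
  ultimately have "continuous_map ?X euclidean (\<lambda>p. D p - D (0, snd p))"
    by (rule continuous_map_group_diff)
  then obtain S where S: "openin euclideanreal S" "0 \<in> S"
      "\<And>t q. t \<in> S \<Longrightarrow> q \<in> K\<^sub>2 \<times> K\<^sub>1 \<Longrightarrow> D (t, q) - D (0, snd (t, q)) \<in> ball 0 (\<epsilon> / 2)"
    by (rule tube_preimage[where K = "K\<^sub>2 \<times> K\<^sub>1" and x = 0 and U = "ball 0 (\<epsilon> / 2)"])
      (use K \<epsilon> in \<open>auto simp: compactin_Times\<close>)
  then obtain d where d: "0 < d" "ball 0 d \<subseteq> S"
    using openE by (metis open_openin)
  have "cmod (iter_deriv k \<alpha> (\<lambda>y. 1 / of_real t * iter_deriv m \<gamma> (rshift (\<beta> t) h) y +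
      (- 1 / of_real t) * iter_deriv m \<gamma> h y) y - iter_deriv k \<alpha> (iter_deriv m \<gamma> ?h') y) < \<epsilon>"
    if t: "t \<noteq> 0" "dist t 0 < d" and \<alpha>: "\<alpha> \<in> K\<^sub>1" and y: "y \<in> K\<^sub>2" for t \<alpha> y
  proof -
    let ?f = "\<lambda>t. iter_deriv (m + k) (\<eta> \<alpha>) (rshift (\<beta> t) h) y"
    have r0: "rshift (\<beta> 0) f = f" for f by (simp add: fun_eq_iff rshift_def one_param_zero[OF \<beta>])
    have \<eta>: "\<eta> \<alpha> i \<in> one_param" if "i < m + k" for i
      using that \<gamma> K1[OF \<alpha>] by (auto simp: \<eta>_def)
    \<comment> \<open>Mean value inequality on the segment from 0 to \<open>t\<close>:
      \<open>D\<close> is the derivative of \<open>?f\<close>, and the linearization error is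
      controlled by the oscillation of \<open>D\<close>. Dividing by \<open>t\<close> leaves
      \<open>\<epsilon> / 2\<close>.\<close>
    have "norm (?f t - ?f 0 - (t - 0) *\<^sub>R D (0, y, \<alpha>)) \<le> norm (t - 0) * (\<epsilon> / 2)"
    proof (rule vector_differentiable_bound_linearization[where S = "ball 0 d" and ?x0.0 = 0 and f' = "\<lambda>t. D (t, y, \<alpha>)"])
      show "(?f has_vector_derivative D (s, y, \<alpha>)) (at s within ball 0 d)" for s
        unfolding D_def using rshift_vector_derivative[OF h \<beta> \<eta>, of "m + k"]
        by (simp add: has_vector_derivative_at_within)
      show "closed_segment 0 t \<subseteq> ball 0 d"
        using t d by (intro closed_segment_subset) (auto simp: dist_commute)
      show "norm (D (s, y, \<alpha>) - D (0, y, \<alpha>)) \<le> \<epsilon> / 2" if "s \<in> ball 0 d" for s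
        using S(3)[of s "(y, \<alpha>)"] d that \<alpha> y by (auto simp: subset_iff)
    qed (use d in auto)
    then have *: "cmod (?f t - ?f 0 - of_real t * D (0, y, \<alpha>)) \<le> \<bar>t\<bar> * (\<epsilon> / 2)"
      by (simp add: scaleR_conv_of_real)
    have "iter_deriv k \<alpha> (\<lambda>y. 1 / of_real t * iter_deriv m \<gamma> (rshift (\<beta> t) h) y +
        (- 1 / of_real t) * iter_deriv m \<gamma> h y) y =
        1 / of_real t * iter_deriv k \<alpha> (iter_deriv m \<gamma> (rshift (\<beta> t) h)) y +
        (- 1 / of_real t) * iter_deriv k \<alpha> (iter_deriv m \<gamma> h) y"
      by (subst iter_deriv_linear) (auto intro: C_infty_iter_deriv rh h \<gamma> K1[OF \<alpha>])
    moreover have "iter_deriv k \<alpha> (iter_deriv m \<gamma> (rshift (\<beta> t) h)) y = ?f t"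
      "iter_deriv k \<alpha> (iter_deriv m \<gamma> h) y = ?f 0"
      "iter_deriv k \<alpha> (iter_deriv m \<gamma> ?h') y = D (0, y, \<alpha>)"
      unfolding iter_deriv_iter_deriv D_def \<eta>_def fst_conv snd_conv r0 by (rule refl)+
    ultimately have "iter_deriv k \<alpha> (\<lambda>y. 1 / of_real t * iter_deriv m \<gamma> (rshift (\<beta> t) h) y +
        (- 1 / of_real t) * iter_deriv m \<gamma> h y) y - iter_deriv k \<alpha> (iter_deriv m \<gamma> ?h') y =
        (?f t - ?f 0 - of_real t * D (0, y, \<alpha>)) / of_real t"
      using t(1) by (simp only:) (simp add: diff_divide_distrib)
    then have "cmod (iter_deriv k \<alpha> (\<lambda>y. 1 / of_real t * iter_deriv m \<gamma> (rshift (\<beta> t) h) y +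
        (- 1 / of_real t) * iter_deriv m \<gamma> h y) y - iter_deriv k \<alpha> (iter_deriv m \<gamma> ?h') y) =
        cmod (?f t - ?f 0 - of_real t * D (0, y, \<alpha>)) / \<bar>t\<bar>"
      by (simp only: norm_divide norm_of_real)
    moreover have "cmod (?f t - ?f 0 - of_real t * D (0, y, \<alpha>)) / \<bar>t\<bar> \<le> \<epsilon> / 2"
      using * t(1) by (simp only: pos_divide_le_eq zero_less_abs_iff mult.commute not_False_eq_True)
    ultimately show ?thesis using \<epsilon> by linarith
  qed
  then show "\<forall>\<^sub>F t in at 0. \<forall>\<alpha>\<in>K\<^sub>1. \<forall>y\<in>K\<^sub>2. cmod (iter_deriv k \<alpha> (\<lambda>y. 1 / of_real t * iter_deriv m \<gamma> (rshift (\<beta> t) h) y +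
      (- 1 / of_real t) * iter_deriv m \<gamma> h y) y - iter_deriv k \<alpha> (iter_deriv m \<gamma> ?h') y) < \<epsilon>"
    unfolding eventually_at using d(1) by (intro exI[of _ d]) auto
qed

lemma E_dual_linear:
  assumes "u \<in> E_dual" "f \<in> C_infty" "g \<in> C_infty"
  shows "u (\<lambda>x. c * f x + d * g x) = c * u f + d * u g"
proof -
  have cf: "(\<lambda>x. c * f x) \<in> C_infty" "(\<lambda>x. d * g x) \<in> C_infty"
    using C_infty_linear[OF assms(2,3), of c 0] C_infty_linear[OF assms(2,3), of 0 d] by simp_all
  then show ?thesis using assms unfolding E_dual_def by simp
qed

text \<open>Since \<open>- (x + \<beta> t) = - \<beta> t - x\<close>, moving \<open>x\<close> along
  \<open>\<beta>\<close> translates \<open>rshift (- x) h\<close> along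
  \<open>neg_path \<beta>\<close>. Linearity pulls the difference quotient under \<open>u\<close>,
  and continuity of \<open>u\<close> carries the limit over from \<E>(G).\<close>

lemma diff_quot_dual_tendsto:
  assumes h: "h \<in> C_infty" and u: "u \<in> E_dual" and \<beta>: "\<beta> \<in> one_param"
    and \<gamma>: "\<And>i. i < m \<Longrightarrow> \<gamma> i \<in> one_param"
  shows "(diff_quot \<beta> (\<lambda>x. u (iter_deriv m \<gamma> (rshift (- x) h))) x \<longlongrightarrow>
    u (iter_deriv m \<gamma> (dir_deriv (neg_path \<beta>) (rshift (- x) h)))) (at 0)"
proof -
  let ?h = "rshift (- x) h" and ?b = "neg_path \<beta>"
  have h': "?h \<in> C_infty" by (rule C_infty_rshift[OF h])
  have "continuous_map E_space euclidean u" using u by (simp add: E_dual_def)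
  from continuous_map_limit[OF this limitin_iter_deriv_rshift[OF h' neg_path_one_param[OF \<beta>] \<gamma>]]
  have "((\<lambda>t. u (\<lambda>y. 1 / of_real t * iter_deriv m \<gamma> (rshift (?b t) ?h) y + (- 1 / of_real t) * iter_deriv m \<gamma> ?h y))
     \<longlongrightarrow> u (iter_deriv m \<gamma> (dir_deriv ?b ?h))) (at 0)" by (simp add: comp_def)
  moreover have "u (\<lambda>y. 1 / of_real t * iter_deriv m \<gamma> (rshift (?b t) ?h) y + (- 1 / of_real t) * iter_deriv m \<gamma> ?h y) =
     diff_quot \<beta> (\<lambda>x. u (iter_deriv m \<gamma> (rshift (- x) h))) x t" for t
  proof -
    have "rshift (- (x + \<beta> t)) h = rshift (?b t) ?h"
      by (simp add: fun_eq_iff rshift_def neg_path_def minus_add diff_conv_add_uminus add.assoc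
          del: add_uminus_conv_diff)
    moreover have "u (\<lambda>y. 1 / of_real t * iter_deriv m \<gamma> (rshift (?b t) ?h) y + (- 1 / of_real t) * iter_deriv m \<gamma> ?h y) =
        1 / of_real t * u (iter_deriv m \<gamma> (rshift (?b t) ?h)) + (- 1 / of_real t) * u (iter_deriv m \<gamma> ?h)"
      by (intro E_dual_linear u C_infty_iter_deriv C_infty_rshift h \<gamma>)
    ultimately show ?thesis
      by (simp only: diff_quot_def) (simp add: diff_divide_distrib)
  qed
  ultimately show ?thesis by simp
qed

text \<open>Each further derivative of the outer function acts directly on the translate, before the
  derivatives already present under \<open>u\<close>; hence the reversed index
  \<open>n - 1 - i\<close>.\<close>

lemma iter_deriv_dual_rshift:
  assumes h: "h \<in> C_infty" and u: "u \<in> E_dual" and \<gamma>: "\<And>i. i < n \<Longrightarrow> \<gamma> i \<in> one_param"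
  shows "iter_deriv n \<gamma> (\<lambda>x. u (rshift (- x) h)) =
    (\<lambda>x. u (iter_deriv n (\<lambda>i. neg_path (\<gamma> (n - 1 - i))) (rshift (- x) h)))"
  using \<gamma>
proof (induction n)
  case (Suc n)
  let ?\<delta> = "\<lambda>i. neg_path (\<gamma> (n - 1 - i))"
  have IH: "iter_deriv n \<gamma> (\<lambda>x. u (rshift (- x) h)) = (\<lambda>x. u (iter_deriv n ?\<delta> (rshift (- x) h)))"
    using Suc by simp
  have "dir_deriv (\<gamma> n) (\<lambda>x. u (iter_deriv n ?\<delta> (rshift (- x) h))) x =
      u (iter_deriv n ?\<delta> (dir_deriv (neg_path (\<gamma> n)) (rshift (- x) h)))" for x
    by (intro dir_deriv_eqI(2) diff_quot_dual_tendsto h u neg_path_one_param Suc.prems) auto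
  then have "iter_deriv (Suc n) \<gamma> (\<lambda>x. u (rshift (- x) h)) =
      (\<lambda>x. u (iter_deriv n ?\<delta> (dir_deriv (neg_path (\<gamma> n)) (rshift (- x) h))))"
    by (simp only: iter_deriv.simps(2) IH) (simp only: fun_eq_iff simp_thms)
  \<comment> \<open>Prepending puts \<open>\<gamma> n\<close> at index 0, and for positive
    \<open>i\<close> one has \<open>n - 1 - (i - 1) = Suc n - 1 - i\<close>.\<close>
  moreover have "iter_deriv n ?\<delta> (dir_deriv (neg_path (\<gamma> n)) f) =
      iter_deriv (Suc n) (\<lambda>i. neg_path (\<gamma> (Suc n - 1 - i))) f" for f
    unfolding iter_deriv_dir_deriv by (rule iter_deriv_cong) auto
  ultimately show ?case by (simp only:)
qed simp

text \<open>The derivative formula factors each derivative through a continuous map into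
  \<open>E_space\<close> followed by \<open>u\<close>. Existence of the next derivative comes from
  the difference quotient lemma.\<close>

lemma C_infty_dual_rshift:
  assumes h: "h \<in> C_infty" and u: "u \<in> E_dual"
  shows "(\<lambda>x. u (rshift (- x) h)) \<in> C_infty"
proof (rule C_inftyI)
  fix n :: nat and \<alpha> :: "nat \<Rightarrow> real \<Rightarrow> 'a" and \<beta> :: "real \<Rightarrow> 'a" and g
  assume \<alpha>: "\<And>i. i < n \<Longrightarrow> \<alpha> i \<in> one_param" and \<beta>: "\<beta> \<in> one_param"
  have "has_dir_deriv \<beta> (\<lambda>x. u (iter_deriv n (\<lambda>i. neg_path (\<alpha> (n - 1 - i))) (rshift (- x) h))) g"
    by (rule dir_deriv_eqI(1), rule diff_quot_dual_tendsto[OF h u \<beta>], rule neg_path_one_param, rule \<alpha>) simp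
  then show "has_dir_deriv \<beta> (iter_deriv n \<alpha> (\<lambda>x. u (rshift (- x) h))) g"
    by (simp only: iter_deriv_dual_rshift[OF h u \<alpha>])
next
  fix n
  let ?X = "prod_topology euclidean (one_param_pow n) :: ('a \<times> (nat \<Rightarrow> real \<Rightarrow> 'a)) topology"
  let ?\<Phi> = "\<lambda>p. iter_deriv n (\<lambda>i. neg_path (snd p (n - 1 - i))) (rshift (- fst p) h)"
  have op: "snd p i \<in> one_param" if "p \<in> topspace ?X" "i < n" for p i
    using that by (cases p) (simp add: topspace_one_param_pow PiE_iff)
  have "continuous_map ?X E_space ?\<Phi>"
  proof (rule continuous_map_E_space)
    show "?\<Phi> p \<in> C_infty" if "p \<in> topspace ?X" for p
      by (intro C_infty_iter_deriv C_infty_rshift h neg_path_one_param op[OF that]) auto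
    fix k
    let ?Y = "prod_topology euclidean (one_param_pow k) :: ('a \<times> (nat \<Rightarrow> real \<Rightarrow> 'a)) topology"
    let ?Z = "prod_topology ?X ?Y"
    have f: "continuous_map ?Z ?X fst" and s: "continuous_map ?Z ?Y snd"
      by (rule continuous_map_fst continuous_map_snd)+
    show "continuous_map ?Z euclidean (\<lambda>p. iter_deriv k (snd (snd p)) (?\<Phi> (fst p)) (fst (snd p)))"
      \<comment> \<open>The \<open>n\<close> reversed directions and the \<open>k\<close> directions
        testing continuity in \<open>E_space\<close> merge into one derivative of a translate of
        \<open>h\<close>, all of whose data vary continuously.\<close>
      unfolding iter_deriv_iter_deriv
    proof (rule continuous_map_iter_deriv_rshift[OF h])
      show "continuous_map ?Z euclidean (\<lambda>p. fst (snd p))"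
        using continuous_map_compose[OF s continuous_map_fst] by (simp add: comp_def)
      show "continuous_map ?Z euclidean (\<lambda>p. - fst (fst p))"
        using continuous_map_compose[OF f continuous_map_fst]
        by (intro continuous_map_group_minus) (simp add: comp_def)
      fix i assume i: "i < n + k"
      show "continuous_map ?Z one_param_top (\<lambda>p. if i < n then neg_path (snd (fst p) (n - 1 - i)) else snd (snd p) (i - n))"
      proof (cases "i < n")
        case True
        then have "n - 1 - i < n" by simp
        from continuous_map_neg_path[OF continuous_map_compose[OF continuous_map_compose[OF f continuous_map_snd]
          continuous_map_one_param_pow_component[OF this]]] True
        show ?thesis by (simp add: comp_def)
      next
        case False
        then have "i - n < k" using i by simp
        from continuous_map_compose[OF continuous_map_compose[OF s continuous_map_snd]
          continuous_map_one_param_pow_component[OF this]] False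
        show ?thesis by (simp add: comp_def)
      qed
    qed
  qed
  moreover have "continuous_map E_space euclidean u" using u by (simp add: E_dual_def)
  ultimately have "continuous_map ?X euclidean (u \<circ> ?\<Phi>)"
    by (rule continuous_map_compose)
  then show "continuous_map ?X euclidean (\<lambda>p. iter_deriv n (snd p) (\<lambda>x. u (rshift (- x) h)) (fst p))"
    by (rule continuous_map_eq) (simp add: iter_deriv_dual_rshift[OF h u] op)
qed

section \<open>Invariance under inversion, and the convolution\<close>

lemma eval_zero_E_dual: "(\<lambda>h. h 0) \<in> E_dual"
proof -
  have "continuous_map E_space euclidean (\<lambda>h :: 'a \<Rightarrow> complex. h 0)"
    unfolding continuous_map_atin limitin_canonical_iff
  proof (intro ballI tendstoI)
    fix f :: "'a \<Rightarrow> complex" and \<epsilon> :: real assume f: "f \<in> topspace E_space" and \<epsilon>: "0 < \<epsilon>"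
    let ?U = "{h \<in> C_infty. seminorm0 {0} (\<lambda>x. h x - f x) < \<epsilon>}"
    have "seminorm0 {0} \<in> (E_seminorms :: (('a \<Rightarrow> complex) \<Rightarrow> real) set)"
      unfolding E_seminorms_def by (rule UnI1) (auto intro: exI[of _ "{0}"])
    then have "openin E_space ?U"
      unfolding E_space_def openin_topology_generated_by_iff
      using f \<epsilon> by (intro generate_topology_on.Basis) (auto simp: topspace_E_space)
    \<comment> \<open>The supremum runs over \<open>0\<close> and one nonnegative number, so this
      seminorm is exactly the distance of the values at the neutral element.\<close>
    moreover have s: "seminorm0 {0} (\<lambda>x. h x - f x) = cmod (h 0 - f 0)" for h :: "'a \<Rightarrow> complex"
      by (simp add: seminorm0_def cSup_insert sup_max)
    ultimately show "\<forall>\<^sub>F h in atin E_space f. dist (h 0) (f 0) < \<epsilon>"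
      unfolding eventually_atin using f \<epsilon>
      by (intro disjI2 exI[of _ ?U]) (auto simp: topspace_E_space dist_norm)
  qed
  then show ?thesis by (simp add: E_dual_def)
qed

text \<open>Inversion turns left-invariant derivatives into right-invariant ones, so smoothness is
  not immediate. It follows because \<open>h (- x)\<close> is the translate
  \<open>rshift (- x) h\<close> evaluated at the neutral element, which is a continuous
  functional.\<close>

lemma C_infty_check_fun:
  assumes "h \<in> C_infty" shows "check_fun h \<in> C_infty"
proof -
  have "check_fun h = (\<lambda>x. rshift (- x) h 0)"
    by (simp add: fun_eq_iff check_fun_def rshift_def)
  then show ?thesis using C_infty_dual_rshift[OF assms eval_zero_E_dual] by simp
qed

theorem proposition5p1:
  fixes f :: "'a::{topological_group_add,t2_space} \<Rightarrow> complex"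
    and u :: "('a \<Rightarrow> complex) \<Rightarrow> complex"
  assumes "f \<in> topspace E_space"
    and "u \<in> E_dual"
  shows "conv f u \<in> topspace E_space"
proof -
  \<comment> \<open>Both functions fed to \<open>u\<close> send \<open>y\<close> to
    \<open>f (x - y)\<close>.\<close>
  have "conv f u = (\<lambda>x. u (rshift (- x) (check_fun f)))"
    by (intro ext, unfold conv_def check_dual_def, intro arg_cong[of _ _ u])
      (simp add: fun_eq_iff rshift_def check_fun_def)
  then show ?thesis
    using C_infty_dual_rshift[OF C_infty_check_fun] assms by (simp add: topspace_E_space)
qed

end
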